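(* Let $A$ be a finite abelian group of even order and exponent at least $3$, let $y\in A$ have order $2$, and let $G=\mathrm{Dic}(A,y)=\langle A,x \mid x^2=y,\ xax^{-1}=a^{-1}\ (a\in A)\rangle$. Let $S\subseteq G$ with $1\notin S$, $S^{-1}=S$ and $\langle S\rangle=G$, write $S=S_1\cup xS_2$ with $S_1,S_2\subseteq A$, and assume $S_2^{-1}=S_2$. Then $\mathrm{Cay}(G,S)$ is distance integral if and only if $\mathrm{Cay}(G,S)$ is integral.
   Context: The Cayley graph $\mathrm{Cay}(G,S)$ has vertex set $G$ and edges $\{g,h\}$ with $g^{-1}h\in S$. A graph is integral if all eigenvalues of its adjacency matrix are integers; a connected graph is distance integral if all eigenvalues of its distance matrix are integers. *)

theory Defs
  imports "HOL-Algebra.Multiplicative_Group" "HOL-Algebra.Generated_Groups"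
    "Jordan_Normal_Form.Char_Poly"
begin

subsection \<open>Finite simple graphs and integrality\<close>

record 'v sgraph =
  vertices :: "'v set"
  edges :: "'v set set"

definition is_walk :: "'v sgraph \<Rightarrow> 'v \<Rightarrow> 'v list \<Rightarrow> 'v \<Rightarrow> bool" where
  "is_walk \<Gamma> u p v \<longleftrightarrow> p \<noteq> [] \<and> set p \<subseteq> vertices \<Gamma> \<and> hd p = u \<and> last p = v \<and>
     successively (\<lambda>a b. {a, b} \<in> edges \<Gamma>) p"

definition connected_sgraph :: "'v sgraph \<Rightarrow> bool" where
  "connected_sgraph \<Gamma> \<longleftrightarrow> vertices \<Gamma> \<noteq> {} \<and>
     (\<forall>u\<in>vertices \<Gamma>. \<forall>v\<in>vertices \<Gamma>. \<exists>p. is_walk \<Gamma> u p v)"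

text \<open>A walk is the list of its vertices, so its length as a walk is one less than the length
  of the list. The value is unspecified when no walk exists.\<close>

definition graph_dist :: "'v sgraph \<Rightarrow> 'v \<Rightarrow> 'v \<Rightarrow> nat" where
  "graph_dist \<Gamma> u v = (LEAST n. \<exists>p. is_walk \<Gamma> u p v \<and> length p = Suc n)"

text \<open>Matrices indexed by a finite set are turned into matrices indexed by natural numbers through
  an arbitrary enumeration; \<open>eigenvalue_matrix_on\<close> shows that the spectrum does not
  depend on it.\<close>

definition enumeration :: "'v set \<Rightarrow> 'v list" where
  "enumeration V = (SOME vs. set vs = V \<and> distinct vs)"

definition matrix_on :: "'v set \<Rightarrow> ('v \<Rightarrow> 'v \<Rightarrow> complex) \<Rightarrow> complex mat" where
  "matrix_on V f = mat (card V) (card V) (\<lambda>(i, j). f (enumeration V ! i) (enumeration V ! j))"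

definition adjacency_matrix :: "'v sgraph \<Rightarrow> complex mat" where
  "adjacency_matrix \<Gamma> = matrix_on (vertices \<Gamma>) (\<lambda>u v. if {u, v} \<in> edges \<Gamma> then 1 else 0)"

definition distance_matrix :: "'v sgraph \<Rightarrow> complex mat" where
  "distance_matrix \<Gamma> = matrix_on (vertices \<Gamma>) (\<lambda>u v. of_nat (graph_dist \<Gamma> u v))"

definition integral_graph :: "'v sgraph \<Rightarrow> bool" where
  "integral_graph \<Gamma> \<longleftrightarrow> (\<forall>k. eigenvalue (adjacency_matrix \<Gamma>) k \<longrightarrow> k \<in> \<int>)"

definition distance_integral_graph :: "'v sgraph \<Rightarrow> bool" where
  "distance_integral_graph \<Gamma> \<longleftrightarrow>
     connected_sgraph \<Gamma> \<and> (\<forall>k. eigenvalue (distance_matrix \<Gamma>) k \<longrightarrow> k \<in> \<int>)"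

lemma enumeration:
  assumes "finite V"
  shows "set (enumeration V) = V" "distinct (enumeration V)" "length (enumeration V) = card V"
proof -
  have "set (enumeration V) = V \<and> distinct (enumeration V)"
    unfolding enumeration_def by (rule someI_ex) (rule finite_distinct_list[OF assms])
  then show "set (enumeration V) = V" "distinct (enumeration V)"
    "length (enumeration V) = card V"
    using distinct_card by fastforce+
qed

lemma eigenvalue_matrix_on:
  assumes V: "finite V"
  shows "eigenvalue (matrix_on V f) k \<longleftrightarrow>
    (\<exists>h. (\<exists>v\<in>V. h v \<noteq> 0) \<and> (\<forall>u\<in>V. (\<Sum>v\<in>V. f u v * h v) = k * h u))"
proof -
  let ?e = "\<lambda>i. enumeration V ! i" and ?n = "card V"
  have bij: "bij_betw ?e {..<?n} V"
    using bij_betw_nth[OF enumeration(2)[OF V]] enumeration[OF V] by simp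
  have eV: "?e i \<in> V" if "i < ?n" for i
    using bij that by (auto dest: bij_betwE)
  have sum: "(\<Sum>v\<in>V. g v) = (\<Sum>i<?n. g (?e i))" for g :: "_ \<Rightarrow> complex"
    using sum.reindex_bij_betw[OF bij] by metis
  have all: "(\<forall>u\<in>V. P u) \<longleftrightarrow> (\<forall>i<?n. P (?e i))" for P
    using bij unfolding bij_betw_def by (metis imageE imageI lessThan_iff)
  have ex: "(\<exists>u\<in>V. P u) \<longleftrightarrow> (\<exists>i<?n. P (?e i))" for P
    using bij unfolding bij_betw_def by (metis imageE imageI lessThan_iff)
  have mult: "matrix_on V f *\<^sub>v w = k \<cdot>\<^sub>v w \<longleftrightarrow>
      (\<forall>i<?n. (\<Sum>j<?n. f (?e i) (?e j) * w $ j) = k * w $ i)"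
    if "w \<in> carrier_vec ?n" for w
    using that by (auto simp: matrix_on_def vec_eq_iff scalar_prod_def lessThan_atLeast0)
  have dim: "dim_row (matrix_on V f) = ?n" by (simp add: matrix_on_def)
  show ?thesis
  proof
    assume "eigenvalue (matrix_on V f) k"
    then obtain w where w: "w \<in> carrier_vec ?n" "w \<noteq> 0\<^sub>v ?n" "matrix_on V f *\<^sub>v w = k \<cdot>\<^sub>v w"
      by (auto simp: eigenvalue_def eigenvector_def dim)
    define h where "h = (\<lambda>v. w $ inv_into {..<?n} ?e v)"
    have h: "h (?e i) = w $ i" if "i < ?n" for i
      using that bij by (simp add: h_def bij_betw_def)
    have "\<exists>v\<in>V. h v \<noteq> 0"
      using w(1,2) h by (auto simp: ex vec_eq_iff)
    moreover have "\<forall>u\<in>V. (\<Sum>v\<in>V. f u v * h v) = k * h u"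
      using w mult[OF w(1)] h by (simp add: all sum)
    ultimately show "\<exists>h. (\<exists>v\<in>V. h v \<noteq> 0) \<and> (\<forall>u\<in>V. (\<Sum>v\<in>V. f u v * h v) = k * h u)"
      by blast
  next
    assume "\<exists>h. (\<exists>v\<in>V. h v \<noteq> 0) \<and> (\<forall>u\<in>V. (\<Sum>v\<in>V. f u v * h v) = k * h u)"
    then obtain h where h: "\<exists>v\<in>V. h v \<noteq> 0" "\<forall>u\<in>V. (\<Sum>v\<in>V. f u v * h v) = k * h u"
      by blast
    define w where "w = vec ?n (\<lambda>i. h (?e i))"
    have "w \<in> carrier_vec ?n" by (simp add: w_def)
    moreover have "w \<noteq> 0\<^sub>v ?n"
      using h(1) by (auto simp: ex w_def vec_eq_iff)
    moreover have "matrix_on V f *\<^sub>v w = k \<cdot>\<^sub>v w"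
      using h(2) mult[OF calculation(1)] by (simp add: all sum w_def)
    ultimately show "eigenvalue (matrix_on V f) k"
      by (auto simp: eigenvalue_def eigenvector_def dim)
  qed
qed


subsection \<open>Group presentations\<close>

text \<open>The letter \<open>(g, True)\<close> stands for the generator \<open>g\<close> and \<open>(g, False)\<close> for its formal
  inverse; a relation \<open>(l, r)\<close> stands for the equation \<open>l = r\<close>.\<close>

type_synonym 'g gword = "('g \<times> bool) list"

definition gwords :: "'g set \<Rightarrow> 'g gword set" where
  "gwords X = {w. fst ` set w \<subseteq> X}"

inductive pres_eq :: "'g set \<Rightarrow> ('g gword \<times> 'g gword) set \<Rightarrow> 'g gword \<Rightarrow> 'g gword \<Rightarrow> bool"
  for X R where
  refl: "w \<in> gwords X \<Longrightarrow> pres_eq X R w w"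
| sym: "pres_eq X R v w \<Longrightarrow> pres_eq X R w v"
| trans: "pres_eq X R u v \<Longrightarrow> pres_eq X R v w \<Longrightarrow> pres_eq X R u w"
| cancel: "g \<in> X \<Longrightarrow> u \<in> gwords X \<Longrightarrow> v \<in> gwords X \<Longrightarrow>
    pres_eq X R (u @ [(g, b), (g, \<not> b)] @ v) (u @ v)"
| relation: "(l, r) \<in> R \<Longrightarrow> l \<in> gwords X \<Longrightarrow> r \<in> gwords X \<Longrightarrow>
    u \<in> gwords X \<Longrightarrow> v \<in> gwords X \<Longrightarrow> pres_eq X R (u @ l @ v) (u @ r @ v)"

definition pres_class :: "'g set \<Rightarrow> ('g gword \<times> 'g gword) set \<Rightarrow> 'g gword \<Rightarrow> 'g gword set" where
  "pres_class X R w = {v. pres_eq X R w v}"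

definition presented_group :: "'g set \<Rightarrow> ('g gword \<times> 'g gword) set \<Rightarrow> 'g gword set monoid" where
  "presented_group X R =
     \<lparr>carrier = pres_class X R ` gwords X,
      monoid.mult = (\<lambda>P Q. {w. \<exists>u\<in>P. \<exists>v\<in>Q. pres_eq X R (u @ v) w}),
      one = pres_class X R []\<rparr>"

lemma gwords_simps [simp]:
  "[] \<in> gwords X"
  "(g, b) # w \<in> gwords X \<longleftrightarrow> g \<in> X \<and> w \<in> gwords X"
  "u @ v \<in> gwords X \<longleftrightarrow> u \<in> gwords X \<and> v \<in> gwords X"
  by (auto simp: gwords_def)

lemma pres_eq_gwords:
  "pres_eq X R u v \<Longrightarrow> u \<in> gwords X \<and> v \<in> gwords X"
  by (induction rule: pres_eq.induct) auto

lemma pres_eq_append_left: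
  assumes "pres_eq X R u v" "w \<in> gwords X"
  shows "pres_eq X R (w @ u) (w @ v)"
  using assms
proof (induction rule: pres_eq.induct)
  case (cancel g u v b)
  then show ?case using pres_eq.cancel[of g X "w @ u" v R b] by simp
next
  case (relation l r u v)
  then show ?case using pres_eq.relation[of l r R X "w @ u" v] by simp
qed (auto intro: pres_eq.intros)

lemma pres_eq_append_right:
  assumes "pres_eq X R u v" "w \<in> gwords X"
  shows "pres_eq X R (u @ w) (v @ w)"
  using assms
proof (induction rule: pres_eq.induct)
  case (cancel g u v b)
  then show ?case using pres_eq.cancel[of g X u "v @ w" R b] by simp
next
  case (relation l r u v)
  then show ?case using pres_eq.relation[of l r R X u "v @ w"] by simp
qed (auto intro: pres_eq.intros)

lemma pres_eq_append:
  assumes "pres_eq X R u u'" "pres_eq X R v v'"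
  shows "pres_eq X R (u @ v) (u' @ v')"
  using assms pres_eq_append_left pres_eq_append_right pres_eq_gwords pres_eq.trans by metis

lemma pres_class_eq_iff:
  assumes "u \<in> gwords X"
  shows "pres_class X R u = pres_class X R v \<longleftrightarrow> pres_eq X R u v"
  using assms unfolding pres_class_def
  by (auto intro: pres_eq.intros)

lemma presented_group_simps:
  "carrier (presented_group X R) = pres_class X R ` gwords X"
  "\<one>\<^bsub>presented_group X R\<^esub> = pres_class X R []"
  by (simp_all add: presented_group_def)

lemma presented_group_mult:
  assumes "u \<in> gwords X" "v \<in> gwords X"
  shows "pres_class X R u \<otimes>\<^bsub>presented_group X R\<^esub> pres_class X R v = pres_class X R (u @ v)"
  using assms unfolding presented_group_def pres_class_def
  by (auto intro: pres_eq.refl pres_eq.trans pres_eq_append)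

lemma pres_eq_inverse:
  assumes "w \<in> gwords X"
  shows "\<exists>v\<in>gwords X. pres_eq X R (v @ w) []"
  using assms
proof (induction w)
  case Nil
  then show ?case by (intro bexI[of _ "[]"]) (auto intro: pres_eq.refl)
next
  case (Cons p w)
  obtain g b where p: "p = (g, b)" by force
  with Cons obtain v where v: "v \<in> gwords X" "pres_eq X R (v @ w) []" and g: "g \<in> X"
    and w: "w \<in> gwords X" by auto
  have "pres_eq X R (v @ [(g, \<not> b), (g, \<not> \<not> b)] @ w) (v @ w)"
    using g v w by (intro pres_eq.cancel) auto
  then show ?case
    using v g p by (intro bexI[of _ "v @ [(g, \<not> b)]"]) (auto intro: pres_eq.trans)
qed

lemma presented_group_is_group: "group (presented_group X R)"
proof (rule groupI)
  fix P assume "P \<in> carrier (presented_group X R)"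
  then obtain w where w: "w \<in> gwords X" "P = pres_class X R w"
    by (auto simp: presented_group_simps)
  then obtain v where "v \<in> gwords X" "pres_eq X R (v @ w) []"
    using pres_eq_inverse by blast
  then show "\<exists>Q\<in>carrier (presented_group X R). Q \<otimes>\<^bsub>presented_group X R\<^esub> P = \<one>\<^bsub>presented_group X R\<^esub>"
    using w by (auto simp: presented_group_simps presented_group_mult pres_class_eq_iff)
qed (auto simp: presented_group_simps presented_group_mult)

text \<open>Evaluation of words in a group in which the relations hold.\<close>

primrec gword_eval :: "('h, 'm) monoid_scheme \<Rightarrow> ('g \<Rightarrow> 'h) \<Rightarrow> 'g gword \<Rightarrow> 'h" where
  "gword_eval H f [] = \<one>\<^bsub>H\<^esub>"
| "gword_eval H f (p # w) = (if snd p then f (fst p) else inv\<^bsub>H\<^esub> f (fst p)) \<otimes>\<^bsub>H\<^esub> gword_eval H f w"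

lemma gword_eval_closed:
  assumes "group H" "f \<in> X \<rightarrow> carrier H" "w \<in> gwords X"
  shows "gword_eval H f w \<in> carrier H"
proof -
  interpret group H by fact
  show ?thesis using assms(3)
  proof (induction w)
    case (Cons p w)
    then show ?case using assms(2) by (cases p) (auto intro!: m_closed inv_closed)
  qed simp
qed

lemma gword_eval_append:
  assumes "group H" "f \<in> X \<rightarrow> carrier H" "u \<in> gwords X" "v \<in> gwords X"
  shows "gword_eval H f (u @ v) = gword_eval H f u \<otimes>\<^bsub>H\<^esub> gword_eval H f v"
proof -
  interpret group H by fact
  show ?thesis using assms(3)
  proof (induction u)
    case (Cons p u)
    have "f (fst p) \<in> carrier H" using Cons.prems assms(2) by (cases p) auto
    then show ?case
      using Cons gword_eval_closed[OF assms(1,2)] assms(4) by (cases p) (auto simp: m_assoc)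
  qed (use gword_eval_closed[OF assms(1,2,4)] in simp)
qed

lemma gword_eval_pres_eq:
  assumes "group H" "f \<in> X \<rightarrow> carrier H"
    and rels: "\<And>l r. (l, r) \<in> R \<Longrightarrow> gword_eval H f l = gword_eval H f r"
    and "pres_eq X R u v"
  shows "gword_eval H f u = gword_eval H f v"
proof -
  interpret group H by fact
  show ?thesis using assms(4)
  proof (induction rule: pres_eq.induct)
    case (cancel g u v b)
    have "f g \<in> carrier H" using cancel assms(2) by auto
    then show ?case
      using cancel gword_eval_closed[OF assms(1,2)]
      by (cases b) (simp_all add: gword_eval_append[OF assms(1,2)] m_assoc[symmetric])
  next
    case (relation l r u v)
    then show ?case using rels by (simp add: gword_eval_append[OF assms(1,2)])
  qed auto
qed


subsection \<open>Generalized dicyclic groups\<close>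

datatype 'a dic_gen = DicA 'a | DicX

definition dic_gens :: "('a, 'm) monoid_scheme \<Rightarrow> 'a dic_gen set" where
  "dic_gens A = insert DicX (DicA ` carrier A)"

text \<open>The first family is the multiplication table of \<open>A\<close>, which the notation
  \<open>\<langle>A, x | \<dots>\<rangle>\<close> leaves implicit.\<close>

definition dic_rels ::
    "('a, 'm) monoid_scheme \<Rightarrow> 'a \<Rightarrow> ('a dic_gen gword \<times> 'a dic_gen gword) set" where
  "dic_rels A y =
     {([(DicA a, True), (DicA b, True)], [(DicA (a \<otimes>\<^bsub>A\<^esub> b), True)]) | a b.
        a \<in> carrier A \<and> b \<in> carrier A} \<union>
     {([(DicX, True), (DicX, True)], [(DicA y, True)])} \<union>
     {([(DicX, True), (DicA a, True), (DicX, False)], [(DicA (inv\<^bsub>A\<^esub> a), True)]) | a.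
        a \<in> carrier A}"

definition Dic :: "('a, 'm) monoid_scheme \<Rightarrow> 'a \<Rightarrow> 'a dic_gen gword set monoid" where
  "Dic A y = presented_group (dic_gens A) (dic_rels A y)"

definition dic_emb :: "('a, 'm) monoid_scheme \<Rightarrow> 'a \<Rightarrow> 'a \<Rightarrow> 'a dic_gen gword set" where
  "dic_emb A y a = pres_class (dic_gens A) (dic_rels A y) [(DicA a, True)]"

definition dic_x :: "('a, 'm) monoid_scheme \<Rightarrow> 'a \<Rightarrow> 'a dic_gen gword set" where
  "dic_x A y = pres_class (dic_gens A) (dic_rels A y) [(DicX, True)]"

definition group_exponent :: "('a, 'm) monoid_scheme \<Rightarrow> nat" where
  "group_exponent A = (LEAST n. 0 < n \<and> (\<forall>a\<in>carrier A. a [^]\<^bsub>A\<^esub> n = \<one>\<^bsub>A\<^esub>))"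

definition Cay :: "('g, 'm) monoid_scheme \<Rightarrow> 'g set \<Rightarrow> 'g sgraph" where
  "Cay G S = \<lparr>vertices = carrier G,
     edges = {{g, h} | g h. g \<in> carrier G \<and> h \<in> carrier G \<and> inv\<^bsub>G\<^esub> g \<otimes>\<^bsub>G\<^esub> h \<in> S}\<rparr>"

lemma Dic_is_group: "group (Dic A y)"
  unfolding Dic_def by (rule presented_group_is_group)

lemma dic_emb_closed: "a \<in> carrier A \<Longrightarrow> dic_emb A y a \<in> carrier (Dic A y)"
  by (auto simp: Dic_def dic_emb_def presented_group_simps dic_gens_def)

lemma dic_x_closed: "dic_x A y \<in> carrier (Dic A y)"
  by (auto simp: Dic_def dic_x_def presented_group_simps dic_gens_def)

lemma dic_rel_eq:
  assumes "(l, r) \<in> dic_rels A y" "l \<in> gwords (dic_gens A)" "r \<in> gwords (dic_gens A)"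
  shows "pres_class (dic_gens A) (dic_rels A y) l = pres_class (dic_gens A) (dic_rels A y) r"
  using pres_eq.relation[OF assms, of "[]" "[]"] assms(2) by (simp add: pres_class_eq_iff)

lemma dic_emb_hom:
  assumes "group A"
  shows "dic_emb A y \<in> hom A (Dic A y)"
proof (rule homI)
  interpret group A by fact
  fix a b assume ab: "a \<in> carrier A" "b \<in> carrier A"
  then show "dic_emb A y (a \<otimes>\<^bsub>A\<^esub> b) = dic_emb A y a \<otimes>\<^bsub>Dic A y\<^esub> dic_emb A y b"
    using dic_rel_eq[of "[(DicA a, True), (DicA b, True)]" "[(DicA (a \<otimes>\<^bsub>A\<^esub> b), True)]" A y]
    by (auto simp: Dic_def dic_emb_def presented_group_mult dic_gens_def dic_rels_def)
qed (rule dic_emb_closed)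

lemma dic_x_square:
  assumes "y \<in> carrier A"
  shows "dic_x A y \<otimes>\<^bsub>Dic A y\<^esub> dic_x A y = dic_emb A y y"
  using dic_rel_eq[of "[(DicX, True), (DicX, True)]" "[(DicA y, True)]" A y] assms
  by (auto simp: Dic_def dic_emb_def dic_x_def presented_group_mult dic_gens_def dic_rels_def)

lemma dic_x_inv:
  "inv\<^bsub>Dic A y\<^esub> dic_x A y = pres_class (dic_gens A) (dic_rels A y) [(DicX, False)]"
proof -
  interpret group "Dic A y" by (rule Dic_is_group)
  let ?z = "pres_class (dic_gens A) (dic_rels A y) [(DicX, False)]"
  have "?z \<in> carrier (Dic A y)"
    by (auto simp: Dic_def presented_group_simps dic_gens_def)
  moreover have "?z \<otimes>\<^bsub>Dic A y\<^esub> dic_x A y = \<one>\<^bsub>Dic A y\<^esub>"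
    using pres_eq.cancel[of DicX "dic_gens A" "[]" "[]" "dic_rels A y" False]
    by (simp add: Dic_def dic_x_def presented_group_mult presented_group_simps dic_gens_def
        pres_class_eq_iff)
  ultimately show ?thesis by (intro inv_equality dic_x_closed)
qed

lemma dic_x_conj:
  assumes "group A" "a \<in> carrier A"
  shows "dic_x A y \<otimes>\<^bsub>Dic A y\<^esub> dic_emb A y a \<otimes>\<^bsub>Dic A y\<^esub> inv\<^bsub>Dic A y\<^esub> dic_x A y
    = dic_emb A y (inv\<^bsub>A\<^esub> a)"
proof -
  interpret group A by fact
  have mem: "(DicX :: 'a dic_gen) \<in> dic_gens A" "DicA a \<in> dic_gens A"
    "DicA (inv\<^bsub>A\<^esub> a) \<in> dic_gens A"
    using assms(2) by (auto simp: dic_gens_def)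
  have "([(DicX, True), (DicA a, True), (DicX, False)], [(DicA (inv\<^bsub>A\<^esub> a), True)]) \<in> dic_rels A y"
    using assms(2) by (auto simp: dic_rels_def)
  from dic_rel_eq[OF this] mem show ?thesis
    unfolding dic_x_inv unfolding Dic_def dic_emb_def dic_x_def
    by (simp add: presented_group_mult)
qed

text \<open>The normal form: \<open>(a, e)\<close> represents \<open>x\<^sup>e a\<close>.\<close>

definition dic_model :: "('a, 'm) monoid_scheme \<Rightarrow> 'a \<Rightarrow> ('a \<times> bool) monoid" where
  "dic_model A y =
     \<lparr>carrier = carrier A \<times> UNIV,
      monoid.mult = (\<lambda>(a, e) (b, f).
        ((if e \<and> f then y else \<one>\<^bsub>A\<^esub>) \<otimes>\<^bsub>A\<^esub> ((if f then inv\<^bsub>A\<^esub> a else a) \<otimes>\<^bsub>A\<^esub> b), e \<noteq> f)),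
      one = (\<one>\<^bsub>A\<^esub>, False)\<rparr>"

definition dic_eval :: "('a, 'm) monoid_scheme \<Rightarrow> 'a dic_gen \<Rightarrow> 'a \<times> bool" where
  "dic_eval A g = (case g of DicA a \<Rightarrow> (a, False) | DicX \<Rightarrow> (\<one>\<^bsub>A\<^esub>, True))"

context
  fixes A :: "('a, 'm) monoid_scheme" (structure) and y :: 'a
  assumes A: "comm_group A" and y: "y \<in> carrier A" "y \<otimes> y = \<one>"
begin

interpretation comm_group A by (rule A)

lemma dic_model_is_group: "group (dic_model A y)"
proof (rule groupI)
  have yinv: "inv y = y" using y by (simp add: inv_equality)
  show "p \<otimes>\<^bsub>dic_model A y\<^esub> q \<otimes>\<^bsub>dic_model A y\<^esub> r = p \<otimes>\<^bsub>dic_model A y\<^esub> (q \<otimes>\<^bsub>dic_model A y\<^esub> r)"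
    if "p \<in> carrier (dic_model A y)" "q \<in> carrier (dic_model A y)" "r \<in> carrier (dic_model A y)"
    for p q r
    using that y yinv
    by (auto simp: dic_model_def inv_mult m_ac split: prod.splits if_splits)
  show "\<exists>q\<in>carrier (dic_model A y). q \<otimes>\<^bsub>dic_model A y\<^esub> p = \<one>\<^bsub>dic_model A y\<^esub>"
    if "p \<in> carrier (dic_model A y)" for p
  proof -
    obtain a e where "p = (a, e)" by (cases p)
    with that have p: "p = (a, e)" "a \<in> carrier A" by (simp_all add: dic_model_def)
    show ?thesis
      using y yinv p
      by (intro bexI[of _ "(if e then y \<otimes> a else inv a, e)"])
         (auto simp: dic_model_def inv_mult m_assoc[symmetric])
  qed
qed (use y in \<open>auto simp: dic_model_def\<close>)

lemma dic_eval_closed: "dic_eval A \<in> dic_gens A \<rightarrow> carrier (dic_model A y)"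
  by (auto simp: dic_eval_def dic_gens_def dic_model_def)

lemma dic_model_inv_x: "inv\<^bsub>dic_model A y\<^esub> (\<one>, True) = (y, True)"
  by (rule group.inv_equality[OF dic_model_is_group]) (use y in \<open>auto simp: dic_model_def\<close>)

lemma dic_eval_rels:
  assumes "(l, r) \<in> dic_rels A y"
  shows "gword_eval (dic_model A y) (dic_eval A) l = gword_eval (dic_model A y) (dic_eval A) r"
proof -
  have yy: "y \<otimes> (y \<otimes> b) = b" if "b \<in> carrier A" for b
    using that y by (simp add: m_assoc[symmetric])
  show ?thesis
    using assms y
    by (auto simp: dic_rels_def dic_eval_def dic_model_inv_x)
       (auto simp: dic_model_def m_ac yy)
qed

lemma pres_class_eval:
  assumes "pres_class (dic_gens A) (dic_rels A y) u = pres_class (dic_gens A) (dic_rels A y) v"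
    and "u \<in> gwords (dic_gens A)"
  shows "gword_eval (dic_model A y) (dic_eval A) u = gword_eval (dic_model A y) (dic_eval A) v"
  using assms gword_eval_pres_eq[OF dic_model_is_group dic_eval_closed dic_eval_rels]
  by (simp add: pres_class_eq_iff)

lemma dic_emb_inj: "inj_on (dic_emb A y) (carrier A)"
proof (rule inj_onI)
  fix a b assume "a \<in> carrier A" "b \<in> carrier A" "dic_emb A y a = dic_emb A y b"
  then show "a = b"
    using pres_class_eval[of "[(DicA a, True)]" "[(DicA b, True)]"]
    by (simp add: dic_emb_def dic_gens_def dic_eval_def dic_model_def)
qed

lemma dic_x_notin: "dic_x A y \<notin> dic_emb A y ` carrier A"
proof
  assume "dic_x A y \<in> dic_emb A y ` carrier A"
  then obtain a where "a \<in> carrier A" "dic_x A y = dic_emb A y a" by auto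
  then show False
    using pres_class_eval[of "[(DicX, True)]" "[(DicA a, True)]"]
    by (simp add: dic_emb_def dic_x_def dic_gens_def dic_eval_def dic_model_def)
qed

lemma Dic_carrier:
  "carrier (Dic A y) =
     dic_emb A y ` carrier A \<union> (dic_x A y <#\<^bsub>Dic A y\<^esub> (dic_emb A y ` carrier A))"
proof -
  let ?D = "Dic A y" and ?x = "dic_x A y" and ?i = "dic_emb A y"
  let ?c = "pres_class (dic_gens A) (dic_rels A y)"
  let ?N = "?i ` carrier A \<union> (?x <#\<^bsub>?D\<^esub> (?i ` carrier A))"
  interpret D: group ?D by (rule Dic_is_group)
  interpret i: group_hom A ?D ?i
    by unfold_locales (rule dic_emb_hom[OF is_group])
  have x: "?x \<in> carrier ?D" by (rule dic_x_closed)
  have xx: "?x \<otimes>\<^bsub>?D\<^esub> ?x = ?i y" using y(1) by (rule dic_x_square)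
  have N: "p \<in> ?N \<longleftrightarrow> (\<exists>a\<in>carrier A. p = ?i a \<or> p = ?x \<otimes>\<^bsub>?D\<^esub> ?i a)" for p
    by (auto simp: l_coset_def)
  have swap: "?i a \<otimes>\<^bsub>?D\<^esub> ?x = ?x \<otimes>\<^bsub>?D\<^esub> ?i (inv a)" if a: "a \<in> carrier A" for a
  proof -
    have "?x \<otimes>\<^bsub>?D\<^esub> ?i (inv a) \<otimes>\<^bsub>?D\<^esub> inv\<^bsub>?D\<^esub> ?x = ?i a"
      using dic_x_conj[OF is_group, of "inv a" y] a by simp
    then have "?i a \<otimes>\<^bsub>?D\<^esub> ?x = ?x \<otimes>\<^bsub>?D\<^esub> ?i (inv a) \<otimes>\<^bsub>?D\<^esub> inv\<^bsub>?D\<^esub> ?x \<otimes>\<^bsub>?D\<^esub> ?x"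
      by simp
    also have "\<dots> = ?x \<otimes>\<^bsub>?D\<^esub> ?i (inv a)"
      using a x by (simp add: D.m_assoc del: i.hom_inv)
    finally show ?thesis .
  qed
  have left_i: "?i a \<otimes>\<^bsub>?D\<^esub> p \<in> ?N" if a: "a \<in> carrier A" and p: "p \<in> ?N" for a p
  proof -
    obtain b where b: "b \<in> carrier A" "p = ?i b \<or> p = ?x \<otimes>\<^bsub>?D\<^esub> ?i b" using p N by blast
    have "?i a \<otimes>\<^bsub>?D\<^esub> ?i b = ?i (a \<otimes> b)" using a b by simp
    moreover have "?i a \<otimes>\<^bsub>?D\<^esub> (?x \<otimes>\<^bsub>?D\<^esub> ?i b) = ?x \<otimes>\<^bsub>?D\<^esub> ?i (inv a \<otimes> b)"
      using a b x swap[OF a] by (simp add: D.m_assoc[symmetric] del: i.hom_inv)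
    ultimately show ?thesis using a b unfolding N by (metis inv_closed m_closed)
  qed
  have left_x: "?x \<otimes>\<^bsub>?D\<^esub> p \<in> ?N" if p: "p \<in> ?N" for p
  proof -
    obtain b where b: "b \<in> carrier A" "p = ?i b \<or> p = ?x \<otimes>\<^bsub>?D\<^esub> ?i b" using p N by blast
    have "?x \<otimes>\<^bsub>?D\<^esub> (?x \<otimes>\<^bsub>?D\<^esub> ?i b) = ?i (y \<otimes> b)"
      using b x y xx by (simp add: D.m_assoc[symmetric])
    then show ?thesis using b y unfolding N by (metis m_closed)
  qed
  have "?i y \<otimes>\<^bsub>?D\<^esub> ?x \<otimes>\<^bsub>?D\<^esub> ?x = \<one>\<^bsub>?D\<^esub>"
  proof -
    have "?i y \<otimes>\<^bsub>?D\<^esub> ?x \<otimes>\<^bsub>?D\<^esub> ?x = ?i y \<otimes>\<^bsub>?D\<^esub> ?i y"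
      using x y xx by (simp add: D.m_assoc)
    also have "\<dots> = ?i (y \<otimes> y)" using y(1) by simp
    also have "\<dots> = \<one>\<^bsub>?D\<^esub>" unfolding y(2) by (rule i.hom_one)
    finally show ?thesis .
  qed
  then have xinv: "inv\<^bsub>?D\<^esub> ?x = ?i y \<otimes>\<^bsub>?D\<^esub> ?x"
    using D.inv_equality x y by simp
  have "?c w \<in> ?N" if "w \<in> gwords (dic_gens A)" for w
    using that
  proof (induction w)
    case Nil
    have "?c [] = ?i \<one>" using i.hom_one by (simp add: Dic_def presented_group_simps)
    then show ?case by blast
  next
    case (Cons p w)
    obtain g b where p: "p = (g, b)" by force
    then have gw: "g \<in> dic_gens A" "w \<in> gwords (dic_gens A)" using Cons.prems by auto
    then have cw: "?c w \<in> ?N" "?c w \<in> carrier ?D"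
      using Cons.IH by (auto simp: Dic_def presented_group_simps)
    have split: "?c (p # w) = ?c [(g, b)] \<otimes>\<^bsub>?D\<^esub> ?c w"
      using gw p by (simp add: Dic_def presented_group_mult)
    show ?case
    proof (cases g)
      case DicX
      show ?thesis
      proof (cases b)
        case True
        then show ?thesis using split DicX left_x[OF cw(1)] by (simp add: dic_x_def)
      next
        case False
        then have "?c (p # w) = ?i y \<otimes>\<^bsub>?D\<^esub> (?x \<otimes>\<^bsub>?D\<^esub> ?c w)"
          using split DicX xinv x y cw(2) dic_emb_closed[OF y(1)]
          by (simp add: dic_x_inv[symmetric] D.m_assoc)
        then show ?thesis using left_i[OF y(1) left_x[OF cw(1)]] by simp
      qed
    next
      case (DicA a)
      then have a: "a \<in> carrier A" using gw by (auto simp: dic_gens_def)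
      show ?thesis
      proof (cases b)
        case True
        then show ?thesis using split DicA left_i[OF a cw(1)] by (simp add: dic_emb_def)
      next
        case False
        have "?c [(DicA a, False)] \<otimes>\<^bsub>?D\<^esub> ?i a = \<one>\<^bsub>?D\<^esub>"
          using pres_eq.cancel[of "DicA a" "dic_gens A" "[]" "[]" "dic_rels A y" False] a
          by (simp add: Dic_def dic_emb_def presented_group_mult presented_group_simps
              dic_gens_def pres_class_eq_iff)
        moreover have "?c [(DicA a, False)] \<in> carrier ?D"
          using a by (auto simp: Dic_def presented_group_simps dic_gens_def)
        ultimately have "?c [(DicA a, False)] = ?i (inv a)"
          using a D.inv_equality[of "?c [(DicA a, False)]" "?i a"] by simp
        then show ?thesis using split DicA False left_i[OF inv_closed[OF a] cw(1)] by simp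
      qed
    qed
  qed
  then have "carrier ?D \<subseteq> ?N" by (auto simp: Dic_def presented_group_simps)
  moreover have "?N \<subseteq> carrier ?D" using x by (auto simp: l_coset_def)
  ultimately show ?thesis by (rule equalityI)
qed

end

end

theory Submission
  imports Defs
begin

text \<open>Let \<open>n\<close> be the order of \<open>A\<close>. For an integer-valued \<open>u\<close> on \<open>A\<close> the eigenvalues of the matrix
  \<open>u (g\<^sup>-\<^sup>1 h)\<close> are the character sums of \<open>u\<close>. They are all integers if and only if
  \<open>u (a\<^sup>k) = u a\<close> for all \<open>k\<close> prime to \<open>n\<close>. Suppose that they are integers, and let \<open>p\<close> be a large
  prime. The \<open>p\<close>-th power of the sum at \<open>\<chi>\<close> is the sum at \<open>\<chi>\<^sup>p\<close> plus \<open>p\<close> times an algebraic integer,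
  so the two sums are congruent modulo \<open>p\<close>, and equal because they are bounded independently
  of \<open>p\<close>. Fourier inversion gives \<open>u (a\<^sup>p) = u a\<close>, and \<open>k\<close> is congruent modulo the order of \<open>a\<close> to
  a product of large primes. Conversely, \<open>u\<close> is constant on the set of generators of each cyclic
  subgroup, and the sum of a character over such a set is an integer, by induction on the
  subgroup.

  Write \<open>F = f\<^sub>1 + x f\<^sub>2\<close> for the indicator function of \<open>S\<close> or for the word length with respect
  to \<open>S\<close>. Both \<open>f\<^sub>1\<close> and \<open>f\<^sub>2\<close> are even functions on \<open>A\<close>, and \<open>f\<^sub>2\<close> is invariant under translation
  by \<open>y\<close>, so the eigenvalues belonging to \<open>F\<close> are those belonging to \<open>f\<^sub>1 + f\<^sub>2\<close> and \<open>f\<^sub>1 - f\<^sub>2\<close> on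
  \<open>A\<close>. For \<open>k\<close> prime to \<open>n\<close>, the map fixing \<open>x\<close> and raising \<open>A\<close> to the power \<open>k\<close> is an
  automorphism of \<open>Dic(A, y)\<close>. If it preserves \<open>S\<close> it preserves word length, and conversely \<open>S\<close>
  consists of the elements of length \<open>1\<close>.\<close>


section \<open>Arithmetic of integers and roots of unity\<close>

lemma of_nat_prime_dvd_power_add_diff:
  fixes x y :: "'a :: comm_ring_1"
  assumes "prime p"
  shows "of_nat p dvd (x + y) ^ p - (x ^ p + y ^ p)"
proof -
  have "p > 0" using assms by (simp add: prime_gt_0_nat)
  then have "{..p} = insert 0 (insert p {0<..<p})" by auto
  then have "(x + y) ^ p - (x ^ p + y ^ p)
      = (\<Sum>k\<in>{0<..<p}. of_nat (p choose k) * x ^ k * y ^ (p - k))"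
    using \<open>p > 0\<close> by (simp add: binomial_ring)
  moreover have "(of_nat p :: 'a) dvd of_nat (p choose k) * x ^ k * y ^ (p - k)"
    if "k \<in> {0<..<p}" for k
    using dvd_choose_prime[of k p] that assms by (auto elim!: dvdE)
  ultimately show ?thesis by (simp only: dvd_sum)
qed

lemma prime_dvd_power_self_diff:
  fixes l :: int
  assumes "prime p"
  shows "int p dvd l ^ p - l"
proof -
  have succ: "int p dvd (l + 1) ^ p - l ^ p - 1" for l
    using of_nat_prime_dvd_power_add_diff[OF assms, of l 1] by (simp add: algebra_simps)
  show ?thesis
  proof (induction l rule: int_induct[where k = 0])
    case base
    then show ?case using assms by (simp add: zero_power prime_gt_0_nat)
  next
    case (step1 l)
    then show ?case using dvd_add[OF succ[of l] step1(2)] by (simp add: algebra_simps)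
  next
    case (step2 l)
    then show ?case using dvd_diff[OF step2(2) succ[of "l - 1"]] by (simp add: algebra_simps)
  qed
qed

lemma prime_dvd_poly_power_diff_pcompose:
  fixes h :: "int poly"
  assumes "prime p"
  shows "of_nat p dvd h ^ p - pcompose h (monom 1 p)"
proof (induction h)
  case 0
  then show ?case using assms by (simp add: zero_power prime_gt_0_nat)
next
  case (pCons a q)
  define Y where "Y = [:0, 1:] * q"
  have "int p dvd a ^ p - a" by (rule prime_dvd_power_self_diff[OF assms])
  then have const: "of_nat p dvd [:a:] ^ p - [:a:]"
    by (auto simp: poly_const_pow of_nat_poly const_poly_dvd)
  have "Y ^ p = monom 1 p * q ^ p"
    by (simp only: Y_def power_mult_distrib monom_altdef smult_1_left)
  then have "of_nat p dvd Y ^ p - monom 1 p * pcompose q (monom 1 p)"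
    using pCons.IH by (simp add: right_diff_distrib[symmetric])
  with const have "of_nat p dvd (([:a:] + Y) ^ p - ([:a:] ^ p + Y ^ p)) + ([:a:] ^ p - [:a:])
      + (Y ^ p - monom 1 p * pcompose q (monom 1 p))"
    by (intro dvd_add of_nat_prime_dvd_power_add_diff assms)
  moreover have "pCons a q ^ p - pcompose (pCons a q) (monom 1 p)
      = ([:a:] + Y) ^ p - ([:a:] + monom 1 p * pcompose q (monom 1 p))"
    by (simp add: Y_def pcompose_pCons)
  ultimately show ?case by (simp add: algebra_simps del: minus_pCons)
qed

lemma sum_power_roots_of_unity:
  assumes "j < n"
  shows "(\<Sum>w::complex | w ^ n = 1. w ^ j) = (if j = 0 then of_nat n else 0)"
proof (cases "j = 0")
  case True
  then show ?thesis using assms by (simp add: card_roots_unity_eq)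
next
  case False
  have "\<not> {w::complex. w ^ n = 1} \<subseteq> {w. w ^ j = 1}"
    using card_mono[OF finite_roots_unity[of j], of "{w::complex. w ^ n = 1}"] False assms
    by (auto simp: card_roots_unity_eq)
  then obtain v :: complex where v: "v ^ n = 1" "v ^ j \<noteq> 1" by auto
  then have "v \<noteq> 0" using assms by (auto simp: power_0_left)
  have "(\<Sum>w | w ^ n = 1. w ^ j) = (\<Sum>w | w ^ n = 1. (v * w) ^ j)"
    by (rule sum.reindex_bij_witness[of _ "\<lambda>w. v * w" "\<lambda>w. w / v"])
       (use v \<open>v \<noteq> 0\<close> in \<open>auto simp: power_mult_distrib power_divide\<close>)
  also have "\<dots> = v ^ j * (\<Sum>w | w ^ n = 1. w ^ j)"
    by (simp add: power_mult_distrib sum_distrib_left)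
  finally show ?thesis using v(2) False by simp
qed

lemma algebraic_int_eigenvalue_matrix_on:
  assumes V: "finite V" and l: "eigenvalue (matrix_on V (\<lambda>u v. of_int (f u v))) l"
  shows "algebraic_int l"
proof -
  let ?n = "card V"
  define M where "M = mat ?n ?n (\<lambda>(i, j). f (enumeration V ! i) (enumeration V ! j))"
  have M: "M \<in> carrier_mat ?n ?n" by (simp add: M_def)
  have "matrix_on V (\<lambda>u v. of_int (f u v)) = map_mat of_int M"
    by (auto simp: matrix_on_def M_def)
  then have "poly (of_int_poly (char_poly M)) l = 0"
    using l M eigenvalue_root_char_poly[of "map_mat of_int M :: complex mat" ?n l]
    by (simp add: of_int_hom.char_poly_hom)
  then show ?thesis
    using degree_monic_char_poly[OF M] by (auto simp: algebraic_int_altdef_ipoly)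
qed

text \<open>The powers of \<open>z\<close> form an eigenvector of an integer matrix, with the value of the polynomial
  as eigenvalue.\<close>

lemma algebraic_int_poly_root_of_unity:
  fixes z :: complex
  assumes n: "n > 0" and z: "z ^ n = 1"
  shows "algebraic_int (poly (of_int_poly h) z)"
proof (rule algebraic_int_eigenvalue_matrix_on)
  define f where "f i j = (\<Sum>k | k \<le> degree h \<and> (k + i) mod n = j. coeff h k)" for i j
  have "(\<Sum>j<n. of_int (f i j) * z ^ j) = poly (of_int_poly h) z * z ^ i" for i
  proof -
    have "z ^ ((k + i) mod n) = z ^ k * z ^ i" for k
      using power_mult[of z n "(k + i) div n"] z
      by (metis div_mult_mod_eq mult.commute mult_1 power_add power_one)
    then have "poly (of_int_poly h) z * z ^ i
        = (\<Sum>k\<le>degree h. of_int (coeff h k) * z ^ ((k + i) mod n))"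
      by (simp add: poly_altdef sum_distrib_right mult.assoc)
    also have "\<dots> = (\<Sum>j<n. \<Sum>k | k \<in> {..degree h} \<and> (k + i) mod n = j.
        of_int (coeff h k) * z ^ ((k + i) mod n))"
      using n by (intro sum.group[symmetric]) auto
    finally show ?thesis by (simp add: f_def sum_distrib_right)
  qed
  then show "eigenvalue (matrix_on {..<n} (\<lambda>i j. of_int (f i j))) (poly (of_int_poly h) z)"
    using n by (subst eigenvalue_matrix_on) (auto intro!: exI[of _ "\<lambda>j. z ^ j"] bexI[of _ 0])
qed simp

lemma prime_dvd_poly_root_of_unity_diff:
  fixes z :: complex
  assumes p: "prime p" and n: "n > 0" and z: "z ^ n = 1"
    and l: "poly (of_int_poly h) z = of_int l" and l': "poly (of_int_poly h) (z ^ p) = of_int l'"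
  shows "int p dvd l - l'"
proof -
  obtain r where r: "h ^ p - pcompose h (monom 1 p) = of_nat p * r"
    using prime_dvd_poly_power_diff_pcompose[OF p] by (auto elim: dvdE)
  have "poly (of_int_poly (h ^ p - pcompose h (monom 1 p))) z = of_int (l ^ p - l')"
    using l l' by (simp add: of_int_poly_hom.hom_minus of_int_hom.map_poly_pcompose poly_pcompose
        poly_monom hom_distribs)
  then have "of_nat p * poly (of_int_poly r) z = of_int (l ^ p - l')"
    unfolding r by (simp add: hom_distribs)
  then have "poly (of_int_poly r) z = of_int (l ^ p - l') / of_nat p"
    using p by (simp add: field_simps prime_gt_0_nat)
  moreover have "\<dots> \<in> \<rat>" by simp
  ultimately have "of_int (l ^ p - l') / of_nat p \<in> (\<int> :: complex set)"
    using rational_algebraic_int_is_int algebraic_int_poly_root_of_unity[OF n z, of r] by metis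
  then obtain m where "of_int (l ^ p - l') / of_nat p = (of_int m :: complex)"
    by (auto elim: Ints_cases)
  then have "(of_int (l ^ p - l') :: complex) = of_int (int p * m)"
    using p by (simp add: field_simps prime_gt_0_nat)
  then have "int p dvd l ^ p - l'" unfolding of_int_eq_iff by simp
  then show ?thesis using dvd_diff[OF _ prime_dvd_power_self_diff[OF p, of l]] by fastforce
qed

lemma exists_coprime_in_progression:
  fixes k m n :: nat
  assumes "coprime k m" "n > 0"
  shows "\<exists>j. coprime (k + m * j) n"
proof -
  define j where "j = \<Prod>{q \<in> prime_factors n. \<not> q dvd k}"
  have "\<not> p dvd k + m * j" if p: "prime p" "p dvd n" for p
  proof (cases "p dvd k")
    case True
    have "\<not> p dvd q" if "q \<in> prime_factors n" "\<not> q dvd k" for q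
      using that True p(1) by (metis in_prime_factors_iff primes_dvd_imp_eq)
    then have "\<not> p dvd j"
      unfolding j_def using p(1) by (subst prime_dvd_prod_iff) auto
    moreover have "\<not> p dvd m"
      using True assms(1) p(1) by (metis coprime_common_divisor not_prime_unit)
    ultimately show ?thesis using True p(1) by (simp add: dvd_add_right_iff prime_dvd_mult_iff)
  next
    case False
    then have "p dvd j"
      unfolding j_def using p assms(2) by (intro dvd_prodI) (auto simp: prime_factors_dvd)
    then show ?thesis using False by (simp add: dvd_add_left_iff)
  qed
  then have "coprime (k + m * j) n"
    using prime_factor_nat[of "gcd (k + m * j) n"] by (auto simp: coprime_iff_gcd_eq_1)
  then show ?thesis ..
qed


section \<open>Spectra of group matrices\<close>

context group
begin

lemma sum_translate:
  assumes "g \<in> carrier G"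
  shows "(\<Sum>a\<in>carrier G. f (g \<otimes> a)) = (\<Sum>a\<in>carrier G. f a)"
  by (rule sum.reindex_bij_witness[of _ "\<lambda>a. inv g \<otimes> a" "\<lambda>a. g \<otimes> a"])
     (use assms in \<open>auto simp: m_assoc[symmetric]\<close>)

lemma sum_inv: "(\<Sum>a\<in>carrier G. f (inv a)) = (\<Sum>a\<in>carrier G. f a)"
  by (rule sum.reindex_bij_witness[of _ "\<lambda>a. inv a" "\<lambda>a. inv a"]) auto

definition group_matrix :: "('a \<Rightarrow> complex) \<Rightarrow> complex mat" where
  "group_matrix F = matrix_on (carrier G) (\<lambda>g h. F (inv g \<otimes> h))"

definition integral_spectrum :: "('a \<Rightarrow> complex) \<Rightarrow> bool" where
  "integral_spectrum F \<longleftrightarrow> (\<forall>l. eigenvalue (group_matrix F) l \<longrightarrow> l \<in> \<int>)"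

text \<open>The action of the element \<open>\<Sum> F(a) a\<close> of the group algebra in the right regular
  representation.\<close>

definition regular_rep :: "('a \<Rightarrow> complex) \<Rightarrow> ('a \<Rightarrow> complex) \<Rightarrow> 'a \<Rightarrow> complex" where
  "regular_rep F h g = (\<Sum>a\<in>carrier G. F a * h (g \<otimes> a))"

lemma eigenvalue_group_matrix:
  assumes "finite (carrier G)"
  shows "eigenvalue (group_matrix F) l \<longleftrightarrow>
    (\<exists>h. (\<exists>g\<in>carrier G. h g \<noteq> 0) \<and> (\<forall>g\<in>carrier G. regular_rep F h g = l * h g))"
proof -
  have "(\<Sum>v\<in>carrier G. F (inv g \<otimes> v) * h v) = regular_rep F h g" if g: "g \<in> carrier G" for g h
  proof -
    have "regular_rep F h g = (\<Sum>a\<in>carrier G. F (inv g \<otimes> (g \<otimes> a)) * h (g \<otimes> a))"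
      unfolding regular_rep_def using g by (intro sum.cong) (auto simp: m_assoc[symmetric])
    also have "\<dots> = (\<Sum>v\<in>carrier G. F (inv g \<otimes> v) * h v)"
      by (rule sum_translate[OF g])
    finally show ?thesis by simp
  qed
  then show ?thesis by (simp add: group_matrix_def eigenvalue_matrix_on[OF assms])
qed

lemma regular_rep_linear:
  "regular_rep (\<lambda>a. F a + F' a) h g = regular_rep F h g + regular_rep F' h g"
  "regular_rep (\<lambda>a. F a - F' a) h g = regular_rep F h g - regular_rep F' h g"
  "regular_rep F (\<lambda>a. h a + k a) g = regular_rep F h g + regular_rep F k g"
  "regular_rep F (\<lambda>a. h a - k a) g = regular_rep F h g - regular_rep F k g"
  "regular_rep F (\<lambda>a. c * h a) g = c * regular_rep F h g"
  "regular_rep F (\<lambda>a. - h a) g = - regular_rep F h g"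
  by (simp_all add: regular_rep_def algebra_simps sum.distrib sum_subtractf sum_distrib_left
      sum_negf)

text \<open>An eigenvector \<open>(h, k)\<close> of the block matrix with rows \<open>(F, F')\<close> and \<open>(F', F)\<close>, which is
  diagonalised by \<open>h \<plusminus> k\<close>.\<close>

definition block_eigenvector ::
    "('a \<Rightarrow> complex) \<Rightarrow> ('a \<Rightarrow> complex) \<Rightarrow> complex \<Rightarrow> ('a \<Rightarrow> complex) \<Rightarrow> ('a \<Rightarrow> complex) \<Rightarrow> bool" where
  "block_eigenvector F F' l h k \<longleftrightarrow> (\<exists>g\<in>carrier G. h g \<noteq> 0 \<or> k g \<noteq> 0) \<and>
     (\<forall>g\<in>carrier G. regular_rep F h g + regular_rep F' k g = l * h g \<and>
       regular_rep F' h g + regular_rep F k g = l * k g)"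

lemma block_eigenvector_if_eigenvalue_add:
  assumes "finite (carrier G)" "eigenvalue (group_matrix (\<lambda>a. F a + F' a)) l"
  shows "\<exists>h. block_eigenvector F F' l h h"
proof -
  obtain h where "\<exists>g\<in>carrier G. h g \<noteq> 0"
    "\<And>g. g \<in> carrier G \<Longrightarrow> regular_rep F h g + regular_rep F' h g = l * h g"
    using assms by (auto simp: eigenvalue_group_matrix regular_rep_linear)
  then show ?thesis
    by (intro exI[of _ h]) (auto simp: block_eigenvector_def add.commute)
qed

lemma block_eigenvector_if_eigenvalue_diff:
  assumes "finite (carrier G)" "eigenvalue (group_matrix (\<lambda>a. F a - F' a)) l"
  shows "\<exists>h. block_eigenvector F F' l h (\<lambda>a. - h a)"
proof -
  obtain h where nz: "\<exists>g\<in>carrier G. h g \<noteq> 0"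
    and h: "\<And>g. g \<in> carrier G \<Longrightarrow> regular_rep F h g - regular_rep F' h g = l * h g"
    using assms by (auto simp: eigenvalue_group_matrix regular_rep_linear)
  have "regular_rep F' h g - regular_rep F h g = - (l * h g)" if "g \<in> carrier G" for g
    using h[OF that] by (metis minus_diff_eq)
  then show ?thesis
    using nz h by (intro exI[of _ h]) (auto simp: block_eigenvector_def regular_rep_linear)
qed

lemma eigenvalue_add_or_diff_if_block_eigenvector:
  assumes finite_carrier: "finite (carrier G)" and hk: "block_eigenvector F F' l h k"
  shows "eigenvalue (group_matrix (\<lambda>a. F a + F' a)) l \<or>
    eigenvalue (group_matrix (\<lambda>a. F a - F' a)) l"
proof -
  have h: "regular_rep F h g + regular_rep F' k g = l * h g"
    and k: "regular_rep F' h g + regular_rep F k g = l * k g" if "g \<in> carrier G" for g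
    using hk that by (auto simp: block_eigenvector_def)
  have add: "regular_rep (\<lambda>a. F a + F' a) (\<lambda>a. h a + k a) g = l * (h g + k g)"
    and diff: "regular_rep (\<lambda>a. F a - F' a) (\<lambda>a. h a - k a) g = l * (h g - k g)"
    if "g \<in> carrier G" for g
    by (simp_all add: regular_rep_linear distrib_left right_diff_distrib
        flip: h[OF that] k[OF that])
  obtain g where g: "g \<in> carrier G" "h g \<noteq> 0 \<or> k g \<noteq> 0"
    using hk by (auto simp: block_eigenvector_def)
  have "h g = ((h g + k g) + (h g - k g)) / 2" "k g = ((h g + k g) - (h g - k g)) / 2"
    by simp_all
  then have "h g + k g \<noteq> 0 \<or> h g - k g \<noteq> 0" using g(2) by fastforce
  then show ?thesis
  proof
    assume "h g + k g \<noteq> 0"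
    then have "eigenvalue (group_matrix (\<lambda>a. F a + F' a)) l"
      unfolding eigenvalue_group_matrix[OF finite_carrier]
      using g(1) add by (intro exI[of _ "\<lambda>a. h a + k a"]) auto
    then show ?thesis ..
  next
    assume "h g - k g \<noteq> 0"
    then have "eigenvalue (group_matrix (\<lambda>a. F a - F' a)) l"
      unfolding eigenvalue_group_matrix[OF finite_carrier]
      using g(1) diff by (intro exI[of _ "\<lambda>a. h a - k a"]) auto
    then show ?thesis ..
  qed
qed

lemma ex_block_eigenvector_iff:
  assumes "finite (carrier G)"
  shows "(\<exists>h k. block_eigenvector F F' l h k) \<longleftrightarrow>
    eigenvalue (group_matrix (\<lambda>a. F a + F' a)) l \<or> eigenvalue (group_matrix (\<lambda>a. F a - F' a)) l"
  using block_eigenvector_if_eigenvalue_add block_eigenvector_if_eigenvalue_diff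
    eigenvalue_add_or_diff_if_block_eigenvector assms by meson

end

locale finite_comm_group = comm_group +
  assumes finite_carrier [simp]: "finite (carrier G)"
begin

definition character :: "('a \<Rightarrow> complex) \<Rightarrow> bool" where
  "character \<chi> \<longleftrightarrow> \<chi> \<one> = 1 \<and> (\<forall>a\<in>carrier G. \<forall>b\<in>carrier G. \<chi> (a \<otimes> b) = \<chi> a * \<chi> b)"

lemma character_one: "character \<chi> \<Longrightarrow> \<chi> \<one> = 1"
  by (simp add: character_def)

lemma character_mult:
  "character \<chi> \<Longrightarrow> a \<in> carrier G \<Longrightarrow> b \<in> carrier G \<Longrightarrow> \<chi> (a \<otimes> b) = \<chi> a * \<chi> b"
  by (simp add: character_def)

lemma character_pow:
  assumes "character \<chi>" "a \<in> carrier G"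
  shows "\<chi> (a [^] (k::nat)) = \<chi> a ^ k"
  using assms by (induction k) (auto simp: character_def)

lemma character_mult_inv:
  assumes "character \<chi>" "a \<in> carrier G"
  shows "\<chi> a * \<chi> (inv a) = 1"
  using assms by (simp add: character_one flip: character_mult)

lemma character_power_order:
  assumes "character \<chi>" "a \<in> carrier G"
  shows "\<chi> a ^ Coset.order G = 1"
  using assms by (simp add: pow_order_eq_1 character_one flip: character_pow)

lemma character_comp_inv:
  assumes "character \<chi>"
  shows "character (\<lambda>a. \<chi> (inv a))"
  using assms by (simp add: character_def inv_mult)

lemma character_comp_pow:
  assumes "character \<chi>"
  shows "character (\<lambda>a. \<chi> (a [^] (k::nat)))"
  using assms by (simp add: character_def pow_mult_distrib m_comm)

definition translation_invariant_subspace :: "('a \<Rightarrow> complex) set \<Rightarrow> bool" where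
  "translation_invariant_subspace V \<longleftrightarrow>
     (\<lambda>_. 0) \<in> V \<and> (\<forall>h\<in>V. \<forall>k\<in>V. (\<lambda>a. h a + k a) \<in> V) \<and> (\<forall>h\<in>V. \<forall>c. (\<lambda>a. c * h a) \<in> V) \<and>
     (\<forall>h\<in>V. \<forall>b\<in>carrier G. (\<lambda>a. h (a \<otimes> b)) \<in> V)"

text \<open>For \<open>w\<^sup>n = 1\<close>, where \<open>n\<close> is the order of the group, this is up to the factor \<open>n\<close> the
  projection onto the functions on which translation by \<open>b\<close> is multiplication by \<open>w\<^sup>-\<^sup>1\<close>.\<close>

definition translation_average :: "'a \<Rightarrow> complex \<Rightarrow> ('a \<Rightarrow> complex) \<Rightarrow> 'a \<Rightarrow> complex" where
  "translation_average b w h a = (\<Sum>j<Coset.order G. w ^ j * h (a \<otimes> b [^] j))"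

lemma translation_average_mem:
  assumes V: "translation_invariant_subspace V" and h: "h \<in> V" and b: "b \<in> carrier G"
  shows "translation_average b w h \<in> V"
proof -
  have "(\<lambda>a. \<Sum>j<n. w ^ j * h (a \<otimes> b [^] j)) \<in> V" for n :: nat
    using V h b by (induction n) (simp_all add: translation_invariant_subspace_def)
  then show ?thesis by (simp add: translation_average_def[abs_def])
qed

lemma translation_average_translate:
  assumes w: "w ^ Coset.order G = 1" and b: "b \<in> carrier G" and a: "a \<in> carrier G"
  shows "translation_average b w h (a \<otimes> b) = inverse w * translation_average b w h a"
proof -
  let ?n = "Coset.order G"
  define f where "f j = w ^ j * h (a \<otimes> b [^] j)" for j
  have n: "?n > 0" by (simp add: order_gt_0_iff_finite)
  have "f ?n = f 0" using a b w by (simp add: f_def pow_order_eq_1)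
  have "w * translation_average b w h (a \<otimes> b) = (\<Sum>j<?n. f (Suc j))"
    using a b by (simp add: translation_average_def f_def sum_distrib_left m_assoc mult.assoc
        nat_pow_Suc2[symmetric] del: nat_pow_Suc)
  also have "\<dots> = translation_average b w h a"
    using sum.lessThan_Suc_shift[of f ?n] \<open>f ?n = f 0\<close> by (simp add: translation_average_def f_def)
  finally have "w * translation_average b w h (a \<otimes> b) = translation_average b w h a" .
  moreover have "w \<noteq> 0" using w n by (auto simp: power_0_left)
  ultimately show ?thesis by (simp add: field_simps)
qed

lemma translation_average_eigenvector:
  assumes h: "\<And>a. a \<in> carrier G \<Longrightarrow> h (a \<otimes> c) = z * h a"
    and "a \<in> carrier G" "b \<in> carrier G" "c \<in> carrier G"
  shows "translation_average b w h (a \<otimes> c) = z * translation_average b w h a"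
proof -
  have "h (a \<otimes> c \<otimes> b [^] j) = z * h (a \<otimes> b [^] j)" for j :: nat
    using h[of "a \<otimes> b [^] j"] assms(2-4) by (simp add: m_assoc m_comm[of c])
  then show ?thesis by (simp add: translation_average_def sum_distrib_left mult_ac)
qed

lemma sum_roots_of_unity_translation_average:
  assumes a: "a \<in> carrier G"
  shows "(\<Sum>w | w ^ Coset.order G = 1. translation_average b w h a) = of_nat (Coset.order G) * h a"
proof -
  let ?n = "Coset.order G"
  have n: "?n > 0" by (simp add: order_gt_0_iff_finite)
  have "(\<Sum>w | w ^ ?n = 1. translation_average b w h a)
      = (\<Sum>j<?n. (\<Sum>w | w ^ ?n = 1. w ^ j) * h (a \<otimes> b [^] j))"
    unfolding translation_average_def sum_distrib_right by (rule sum.swap)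
  also have "\<dots> = (\<Sum>j<?n. if j = 0 then of_nat ?n * h a else 0)"
    using a by (intro sum.cong) (auto simp: sum_power_roots_of_unity)
  also have "\<dots> = of_nat ?n * h a" using n a by (simp add: sum.delta)
  finally show ?thesis .
qed

lemma joint_translation_eigenvector:
  assumes V: "translation_invariant_subspace V" and h: "h \<in> V" "\<exists>a\<in>carrier G. h a \<noteq> 0"
    and B: "finite B" "B \<subseteq> carrier G"
  shows "\<exists>k\<in>V. (\<exists>a\<in>carrier G. k a \<noteq> 0) \<and> (\<forall>b\<in>B. \<exists>z. \<forall>a\<in>carrier G. k (a \<otimes> b) = z * k a)"
  using B
proof (induction B)
  case empty
  then show ?case using h by auto
next
  case (insert b B)
  then have b: "b \<in> carrier G" and B: "B \<subseteq> carrier G" by auto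
  obtain k a where k: "k \<in> V" "\<And>c. c \<in> B \<Longrightarrow> \<exists>z. \<forall>a\<in>carrier G. k (a \<otimes> c) = z * k a"
    and a: "a \<in> carrier G" "k a \<noteq> 0"
    using insert by auto
  have "(\<Sum>w | w ^ Coset.order G = 1. translation_average b w k a) \<noteq> 0"
    using a by (simp add: sum_roots_of_unity_translation_average order_gt_0_iff_finite)
  then obtain w where w: "w ^ Coset.order G = 1" "translation_average b w k a \<noteq> 0"
    by (auto dest: sum.not_neutral_contains_not_neutral)
  have "\<exists>z. \<forall>a\<in>carrier G. translation_average b w k (a \<otimes> c) = z * translation_average b w k a"
    if "c \<in> insert b B" for c
  proof (cases "c = b")
    case False
    then obtain z where "\<And>a. a \<in> carrier G \<Longrightarrow> k (a \<otimes> c) = z * k a"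
      using k(2)[of c] \<open>c \<in> insert b B\<close> by blast
    then show ?thesis using translation_average_eigenvector[of k c z] b B \<open>c \<in> insert b B\<close> by blast
  qed (use translation_average_translate[OF w(1) b] in blast)
  then show ?case
    using translation_average_mem[OF V k(1) b] w(2) a(1) by blast
qed

lemma translation_invariant_subspace_contains_character:
  assumes V: "translation_invariant_subspace V" and h: "h \<in> V" "\<exists>a\<in>carrier G. h a \<noteq> 0"
  shows "\<exists>\<chi>\<in>V. character \<chi>"
proof -
  obtain k a where k: "k \<in> V" and a: "a \<in> carrier G" "k a \<noteq> 0"
    and eigen: "\<And>b. b \<in> carrier G \<Longrightarrow> \<exists>z. \<forall>a\<in>carrier G. k (a \<otimes> b) = z * k a"
    using joint_translation_eigenvector[OF V h, of "carrier G"] by auto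
  have mult: "k (a \<otimes> b) * k \<one> = k a * k b" if "a \<in> carrier G" "b \<in> carrier G" for a b
    using eigen[OF that(2)] that by (metis l_one mult.assoc mult.commute one_closed)
  have "k \<one> \<noteq> 0" using mult[OF a(1) inv_closed[OF a(1)]] mult[of a \<one>] mult[of a a] a by auto
  then have "character (\<lambda>a. inverse (k \<one>) * k a)"
    using mult by (auto simp: character_def field_simps)
  then show ?thesis using V k by (auto simp: translation_invariant_subspace_def intro!: bexI)
qed

definition fourier :: "('a \<Rightarrow> complex) \<Rightarrow> ('a \<Rightarrow> complex) \<Rightarrow> complex" where
  "fourier u \<chi> = (\<Sum>a\<in>carrier G. u a * \<chi> a)"

lemma fourier_translate:
  assumes \<chi>: "character \<chi>" and b: "b \<in> carrier G"
  shows "fourier (\<lambda>a. u (a \<otimes> b)) \<chi> = \<chi> (inv b) * fourier u \<chi>"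
proof -
  have "\<chi> (inv b) * fourier u \<chi> = (\<Sum>a\<in>carrier G. \<chi> (inv b) * (u (b \<otimes> a) * \<chi> (b \<otimes> a)))"
    unfolding fourier_def sum_distrib_left by (rule sum_translate[OF b, symmetric])
  also have "\<dots> = (\<Sum>a\<in>carrier G. (\<chi> b * \<chi> (inv b)) * (u (a \<otimes> b) * \<chi> a))"
    using b by (intro sum.cong) (auto simp: character_mult[OF \<chi>] m_comm)
  also have "\<dots> = fourier (\<lambda>a. u (a \<otimes> b)) \<chi>"
    by (simp add: character_mult_inv[OF \<chi> b] fourier_def)
  finally show ?thesis by simp
qed

lemma fourier_eq_0_imp_eq_0:
  assumes u: "\<And>\<chi>. character \<chi> \<Longrightarrow> fourier u \<chi> = 0" and a: "a \<in> carrier G"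
  shows "u a = 0"
proof (rule ccontr)
  assume "u a \<noteq> 0"
  define V where "V = {h. \<forall>\<chi>. character \<chi> \<longrightarrow> fourier h \<chi> = 0}"
  have "fourier (\<lambda>a. h a + k a) \<chi> = fourier h \<chi> + fourier k \<chi>"
    "fourier (\<lambda>a. c * h a) \<chi> = c * fourier h \<chi>" for h k c \<chi>
    by (simp_all add: fourier_def distrib_right sum.distrib sum_distrib_left mult.assoc)
  then have "translation_invariant_subspace V"
    by (auto simp: V_def translation_invariant_subspace_def fourier_translate)
       (simp add: fourier_def)
  moreover have "u \<in> V" using u by (simp add: V_def)
  ultimately obtain \<chi> where \<chi>: "\<chi> \<in> V" "character \<chi>"
    using translation_invariant_subspace_contains_character \<open>u a \<noteq> 0\<close> a by blast
  have "fourier \<chi> (\<lambda>a. \<chi> (inv a)) = of_nat (Coset.order G)"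
    by (simp add: fourier_def character_mult_inv[OF \<chi>(2)] Coset.order_def)
  then show False
    using \<chi> character_comp_inv[OF \<chi>(2)] order_gt_0_iff_finite by (auto simp: V_def)
qed

lemma regular_rep_character:
  assumes "character \<chi>" "g \<in> carrier G"
  shows "regular_rep F \<chi> g = fourier F \<chi> * \<chi> g"
  unfolding regular_rep_def fourier_def sum_distrib_right
  using assms by (intro sum.cong) (auto simp: character_mult)

lemma translation_invariant_subspace_eigenspace:
  "translation_invariant_subspace {h. \<forall>g\<in>carrier G. regular_rep F h g = l * h g}"
proof -
  have "regular_rep F (\<lambda>a. h (a \<otimes> b)) g = regular_rep F h (g \<otimes> b)"
    if "g \<in> carrier G" "b \<in> carrier G" for h g b
    using that by (simp add: regular_rep_def m_ac)
  then show ?thesis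
    by (auto simp: translation_invariant_subspace_def regular_rep_linear algebra_simps)
       (simp add: regular_rep_def)
qed

lemma eigenvalue_group_matrix_iff_fourier:
  "eigenvalue (group_matrix F) l \<longleftrightarrow> (\<exists>\<chi>. character \<chi> \<and> l = fourier F \<chi>)"
proof
  assume "eigenvalue (group_matrix F) l"
  then obtain h where "\<exists>g\<in>carrier G. h g \<noteq> 0" "\<forall>g\<in>carrier G. regular_rep F h g = l * h g"
    unfolding eigenvalue_group_matrix[OF finite_carrier] by blast
  then obtain \<chi> where \<chi>: "character \<chi>" "\<forall>g\<in>carrier G. regular_rep F \<chi> g = l * \<chi> g"
    using translation_invariant_subspace_contains_character
      [OF translation_invariant_subspace_eigenspace] by blast
  then have "l * \<chi> \<one> = fourier F \<chi> * \<chi> \<one>"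
    using regular_rep_character[OF \<chi>(1) one_closed, of F] by (metis one_closed)
  then have "l = fourier F \<chi>" by (simp add: character_one[OF \<chi>(1)])
  then show "\<exists>\<chi>. character \<chi> \<and> l = fourier F \<chi>" using \<chi>(1) by blast
next
  assume "\<exists>\<chi>. character \<chi> \<and> l = fourier F \<chi>"
  then obtain \<chi> where \<chi>: "character \<chi>" "l = fourier F \<chi>" by auto
  then show "eigenvalue (group_matrix F) l"
    unfolding eigenvalue_group_matrix[OF finite_carrier]
    by (intro exI[of _ \<chi>] conjI bexI[of _ \<one>])
       (simp_all add: regular_rep_character character_one[OF \<chi>(1)])
qed

end


section \<open>Integral spectra on finite abelian groups\<close>

definition (in group) cyclic_generators :: "'a set \<Rightarrow> 'a set" where
  "cyclic_generators H = {b \<in> carrier G. generate G {b} = H}"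

lemma (in group) sum_character_subgroup_Ints:
  fixes \<chi> :: "'a \<Rightarrow> complex"
  assumes H: "subgroup H G"
    and \<chi>: "\<And>a b. a \<in> H \<Longrightarrow> b \<in> H \<Longrightarrow> \<chi> (a \<otimes> b) = \<chi> a * \<chi> b"
  shows "(\<Sum>a\<in>H. \<chi> a) \<in> \<int>"
proof (cases "\<forall>a\<in>H. \<chi> a = 1")
  case False
  then obtain b where b: "b \<in> H" "\<chi> b \<noteq> 1" by auto
  have "(\<Sum>a\<in>H. \<chi> a) = (\<Sum>a\<in>H. \<chi> (b \<otimes> a))"
    by (rule sum.reindex_bij_witness[of _ "\<lambda>a. b \<otimes> a" "\<lambda>a. inv b \<otimes> a"])
       (use b H in \<open>auto simp: m_assoc[symmetric] subgroup.mem_carrier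
         intro: subgroup.m_closed subgroup.m_inv_closed\<close>)
  also have "\<dots> = \<chi> b * (\<Sum>a\<in>H. \<chi> a)"
    using b by (simp add: \<chi> sum_distrib_left)
  finally have "(\<Sum>a\<in>H. \<chi> a) = 0" using b(2) by simp
  then show ?thesis by simp
qed simp

lemma (in comm_group) inv_iso: "(\<lambda>a. inv a) \<in> iso G G"
  by (auto simp: iso_def hom_def inv_mult intro!: bij_betw_byWitness[where f' = "\<lambda>a. inv a"])

lemma (in group) generate_singleton_subset:
  assumes "a \<in> carrier G" "b \<in> generate G {a}"
  shows "generate G {b} \<subseteq> generate G {a}"
  using assms by (intro generate_subgroup_incl generate_is_subgroup) auto

lemma (in group) pow_add_mult_ord:
  assumes "a \<in> carrier G"
  shows "a [^] (k + ord a * j :: nat) = a [^] k"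
  using assms by (simp add: nat_pow_mult[symmetric] nat_pow_pow[symmetric])

lemma (in group) generate_eq_imp_pow_coprime:
  assumes finite_carrier: "finite (carrier G)"
    and a: "a \<in> carrier G" and b: "b \<in> carrier G" and gen: "generate G {b} = generate G {a}"
  obtains k :: nat where "coprime k (Coset.order G)" "b = a [^] k"
proof -
  have "b \<in> generate G {a}" using gen by (auto intro: generate.incl)
  then obtain j :: nat where j: "b = a [^] j"
    using generate_pow_on_finite_carrier[OF finite_carrier a] by auto
  have "ord a > 0" using ord_ge_1[OF finite_carrier a] by simp
  have "ord (a [^] j) = ord a" using gen a b j by (simp add: generate_pow_card)
  then have "coprime j (ord a)"
    using ord_pow_gen[OF a, of j] \<open>ord a > 0\<close>
    by (auto simp: coprime_iff_gcd_eq_1 gcd.commute div_eq_dividend_iff split: if_splits)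
  then obtain i where "coprime (j + ord a * i) (Coset.order G)"
    using exists_coprime_in_progression order_gt_0_iff_finite finite_carrier by blast
  then show ?thesis using that pow_add_mult_ord[OF a] j by metis
qed

context finite_comm_group
begin

lemma sum_character_cyclic_generators_Ints:
  assumes \<chi>: "character \<chi>" and "a \<in> carrier G"
  shows "(\<Sum>b\<in>cyclic_generators (generate G {a}). \<chi> b) \<in> \<int>"
  using assms(2)
proof (induction "card (generate G {a})" arbitrary: a rule: less_induct)
  case less
  let ?C = "generate G {a}"
  let ?\<C> = "(\<lambda>b. generate G {b}) ` ?C"
  have C: "subgroup ?C G" using less.prems by (intro generate_is_subgroup) auto
  then have C_subset: "?C \<subseteq> carrier G" by (rule subgroup.subset)
  then have finite_C: "finite ?C" by (rule finite_subset) simp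
  have gens: "{b \<in> ?C. generate G {b} = H} = cyclic_generators H" if "H \<in> ?\<C>" for H
    unfolding cyclic_generators_def
    using that C_subset generate_singleton_subset[OF less.prems] generate.incl[of _ "{_}" G] by blast
  have "(\<Sum>b\<in>?C. \<chi> b) = (\<Sum>H\<in>?\<C>. \<Sum>b | b \<in> ?C \<and> generate G {b} = H. \<chi> b)"
    by (rule sum.image_gen[OF finite_C])
  also have "\<dots> = (\<Sum>H\<in>?\<C>. \<Sum>b\<in>cyclic_generators H. \<chi> b)"
    using gens by (intro sum.cong) auto
  also have "\<dots> = (\<Sum>b\<in>cyclic_generators ?C. \<chi> b) + (\<Sum>H\<in>?\<C> - {?C}. \<Sum>b\<in>cyclic_generators H. \<chi> b)"
    using finite_C by (intro sum.remove) (auto intro: generate.incl)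
  finally have "(\<Sum>b\<in>cyclic_generators ?C. \<chi> b)
      = (\<Sum>b\<in>?C. \<chi> b) - (\<Sum>H\<in>?\<C> - {?C}. \<Sum>b\<in>cyclic_generators H. \<chi> b)" by simp
  moreover have "(\<Sum>b\<in>?C. \<chi> b) \<in> \<int>"
    using C_subset by (intro sum_character_subgroup_Ints[OF C] character_mult[OF \<chi>]) auto
  moreover have "(\<Sum>b\<in>cyclic_generators H. \<chi> b) \<in> \<int>" if H: "H \<in> ?\<C> - {?C}" for H
  proof -
    obtain c where c: "c \<in> ?C" "H = generate G {c}" "H \<noteq> ?C" using H by auto
    then have "H \<subset> ?C" using generate_singleton_subset[OF less.prems] by blast
    then show ?thesis
      using c C_subset less.hyps[of c] psubset_card_mono[OF finite_C] by auto
  qed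
  ultimately show ?case by (auto intro: Ints_diff Ints_sum)
qed

definition power_invariant :: "('a \<Rightarrow> 'c) \<Rightarrow> bool" where
  "power_invariant u \<longleftrightarrow> (\<forall>k::nat. coprime k (Coset.order G) \<longrightarrow>
     (\<forall>a\<in>carrier G. u (a [^] k) = u a))"

lemma power_invariantD:
  "power_invariant u \<Longrightarrow> coprime k (Coset.order G) \<Longrightarrow> a \<in> carrier G \<Longrightarrow> u (a [^] (k::nat)) = u a"
  by (simp add: power_invariant_def)

lemma power_invariant_imp_fourier_Ints:
  fixes u :: "'a \<Rightarrow> int"
  assumes u: "power_invariant u" and \<chi>: "character \<chi>"
  shows "fourier (\<lambda>a. of_int (u a)) \<chi> \<in> \<int>"
proof -
  have "fourier (\<lambda>a. of_int (u a)) \<chi>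
      = (\<Sum>H\<in>(\<lambda>a. generate G {a}) ` carrier G. \<Sum>b\<in>cyclic_generators H. of_int (u b) * \<chi> b)"
    unfolding fourier_def cyclic_generators_def by (rule sum.image_gen) simp
  also have "\<dots> \<in> \<int>"
  proof (rule Ints_sum)
    fix H assume "H \<in> (\<lambda>a. generate G {a}) ` carrier G"
    then obtain a where a: "a \<in> carrier G" "H = generate G {a}" by auto
    have "u b = u a" if "b \<in> cyclic_generators H" for b
    proof -
      obtain k where "coprime k (Coset.order G)" "b = a [^] k"
        using generate_eq_imp_pow_coprime[of a b] finite_carrier a \<open>b \<in> cyclic_generators H\<close>
        by (auto simp: cyclic_generators_def)
      then show ?thesis using power_invariantD[OF u _ a(1)] by simp
    qed
    then have "(\<Sum>b\<in>cyclic_generators H. of_int (u b) * \<chi> b)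
        = of_int (u a) * (\<Sum>b\<in>cyclic_generators H. \<chi> b)"
      by (simp add: sum_distrib_left)
    also have "\<dots> \<in> \<int>"
      unfolding a(2) by (intro Ints_mult Ints_of_int sum_character_cyclic_generators_Ints \<chi> a)
    finally show "(\<Sum>b\<in>cyclic_generators H. of_int (u b) * \<chi> b) \<in> \<int>" .
  qed
  finally show ?thesis .
qed

lemma character_eq_power_root_of_unity:
  assumes "character \<chi>"
  obtains z and e :: "'a \<Rightarrow> nat"
  where "z ^ Coset.order G = 1" "\<And>a. a \<in> carrier G \<Longrightarrow> \<chi> a = z ^ e a"
proof
  let ?n = "Coset.order G"
  let ?z = "cis (2 * pi / real ?n)"
  have n: "?n > 0" by (simp add: order_gt_0_iff_finite)
  then show "?z ^ ?n = 1" by (simp add: DeMoivre)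
  have "\<exists>k. \<chi> a = ?z ^ k" if a: "a \<in> carrier G" for a
  proof -
    have "\<chi> a \<in> {z. z ^ ?n = 1}" using character_power_order[OF assms a] by simp
    then obtain k where "\<chi> a = cis (2 * pi * real k / real ?n)"
      using bij_betw_roots_unity[OF n] by (auto simp: bij_betw_def)
    then show ?thesis by (auto simp: DeMoivre mult_ac)
  qed
  then show "\<chi> a = ?z ^ (SOME k. \<chi> a = ?z ^ k)" if "a \<in> carrier G" for a
    using that by (metis (mono_tags, lifting) someI_ex)
qed

lemma prime_dvd_fourier_comp_pow_diff:
  fixes u :: "'a \<Rightarrow> int"
  assumes p: "prime p" and \<chi>: "character \<chi>"
    and l: "fourier (\<lambda>a. of_int (u a)) \<chi> = of_int l"
    and l': "fourier (\<lambda>a. of_int (u a)) (\<lambda>a. \<chi> (a [^] p)) = of_int l'"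
  shows "int p dvd l - l'"
proof -
  obtain z and e :: "'a \<Rightarrow> nat"
    where z: "z ^ Coset.order G = 1" and e: "\<And>a. a \<in> carrier G \<Longrightarrow> \<chi> a = z ^ e a"
    using character_eq_power_root_of_unity[OF \<chi>] by blast
  define h where "h = (\<Sum>a\<in>carrier G. monom (u a) (e a))"
  have h: "poly (of_int_poly h) w = (\<Sum>a\<in>carrier G. of_int (u a) * w ^ e a)" for w :: complex
    by (simp add: h_def hom_distribs poly_sum poly_monom)
  show ?thesis
  proof (rule prime_dvd_poly_root_of_unity_diff[OF p _ z])
    show "poly (of_int_poly h) z = of_int l"
      unfolding h using l by (simp add: fourier_def e)
    have "\<chi> (a [^] p) = (z ^ p) ^ e a" if "a \<in> carrier G" for a
      unfolding character_pow[OF \<chi> that] e[OF that] by (simp add: mult.commute flip: power_mult)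
    then show "poly (of_int_poly h) (z ^ p) = of_int l'"
      unfolding h l'[symmetric] fourier_def by (intro sum.cong) auto
  qed (simp add: order_gt_0_iff_finite)
qed

lemma norm_fourier_le:
  assumes "character \<chi>"
  shows "norm (fourier u \<chi>) \<le> (\<Sum>a\<in>carrier G. norm (u a))"
proof -
  have "norm (\<chi> a) = 1" if "a \<in> carrier G" for a
    using power_eq_1_iff[OF character_power_order[OF assms that]] order_gt_0_iff_finite by auto
  then show ?thesis
    unfolding fourier_def by (intro sum_norm_le) (simp add: norm_mult)
qed

lemma fourier_comp_pow_eq:
  fixes u :: "'a \<Rightarrow> int"
  assumes u: "\<And>\<chi>. character \<chi> \<Longrightarrow> fourier (\<lambda>a. of_int (u a)) \<chi> \<in> \<int>"
    and p: "prime p" "int p > 2 * (\<Sum>a\<in>carrier G. \<bar>u a\<bar>)" and \<chi>: "character \<chi>"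
  shows "fourier (\<lambda>a. of_int (u a)) (\<lambda>a. \<chi> (a [^] p)) = fourier (\<lambda>a. of_int (u a)) \<chi>"
proof -
  let ?M = "\<Sum>a\<in>carrier G. \<bar>u a\<bar>"
  have bounded: "\<exists>l. fourier (\<lambda>a. of_int (u a)) \<psi> = of_int l \<and> \<bar>l\<bar> \<le> ?M" if \<psi>: "character \<psi>" for \<psi>
  proof -
    obtain l where l: "fourier (\<lambda>a. of_int (u a)) \<psi> = of_int l"
      using u[OF \<psi>] by (auto elim: Ints_cases)
    have "norm (fourier (\<lambda>a. of_int (u a)) \<psi>) \<le> of_int ?M"
      using norm_fourier_le[OF \<psi>, of "\<lambda>a. of_int (u a)"] by simp
    then have "\<bar>l\<bar> \<le> ?M" unfolding l by (simp flip: of_int_abs of_int_sum)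
    with l show ?thesis by blast
  qed
  obtain l where l: "fourier (\<lambda>a. of_int (u a)) \<chi> = of_int l" "\<bar>l\<bar> \<le> ?M"
    using bounded[OF \<chi>] by blast
  obtain l' where l': "fourier (\<lambda>a. of_int (u a)) (\<lambda>a. \<chi> (a [^] p)) = of_int l'" "\<bar>l'\<bar> \<le> ?M"
    using bounded[OF character_comp_pow[OF \<chi>]] by blast
  have "int p dvd l - l'" by (rule prime_dvd_fourier_comp_pow_diff[OF p(1) \<chi> l(1) l'(1)])
  moreover have "\<bar>l - l'\<bar> < int p" using l(2) l'(2) p(2) by linarith
  ultimately have "l = l'" using dvd_imp_le_int[of "l - l'" "int p"] by fastforce
  then show ?thesis using l l' by simp
qed

lemma pow_iso:
  assumes k: "coprime k (Coset.order G)"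
  shows "(\<lambda>a. a [^] (k::nat)) \<in> iso G G"
proof (rule isoI)
  show "(\<lambda>a. a [^] k) \<in> hom G G" by (auto simp: hom_def pow_mult_distrib m_comm)
  then interpret pow: group_hom G G "\<lambda>a. a [^] k" by unfold_locales
  have "a = \<one>" if a: "a \<in> carrier G" "a [^] k = \<one>" for a
  proof -
    have "ord a dvd k" "ord a dvd Coset.order G"
      using a by (simp_all add: pow_eq_id ord_dvd_group_order)
    then have "ord a = 1" using k by (metis coprime_common_divisor_nat nat_dvd_1_iff_1)
    then show ?thesis using a(1) ord_eq_1 by blast
  qed
  then have "inj_on (\<lambda>a. a [^] k) (carrier G)"
    using pow.inj_on_one_iff by blast
  then show "bij_betw (\<lambda>a. a [^] k) (carrier G) (carrier G)"
    by (simp add: bij_betw_def endo_inj_surj image_subset_iff)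
qed

lemma comp_pow_eq_large_prime:
  fixes u :: "'a \<Rightarrow> int"
  assumes u: "\<And>\<chi>. character \<chi> \<Longrightarrow> fourier (\<lambda>a. of_int (u a)) \<chi> \<in> \<int>"
    and p: "prime p" "int p > 2 * (\<Sum>a\<in>carrier G. \<bar>u a\<bar>)" "coprime p (Coset.order G)"
    and a: "a \<in> carrier G"
  shows "u (a [^] p) = u a"
proof -
  let ?root = "inv_into (carrier G) (\<lambda>a. a [^] p)"
  have bij: "bij_betw (\<lambda>a. a [^] p) (carrier G) (carrier G)"
    using pow_iso[OF p(3)] by (simp add: iso_def)
  then have root: "?root (a [^] p) = a" if "a \<in> carrier G" for a
    using inv_into_f_f[of "\<lambda>a. a [^] p"] that by (simp add: bij_betw_def)
  have "fourier (\<lambda>b. of_int (u (?root b)) - of_int (u b)) \<chi> = 0" if \<chi>: "character \<chi>" for \<chi>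
  proof -
    have "fourier (\<lambda>b. of_int (u (?root b))) \<chi>
        = (\<Sum>a\<in>carrier G. of_int (u (?root (a [^] p))) * \<chi> (a [^] p))"
      unfolding fourier_def by (rule sum.reindex_bij_betw[OF bij, symmetric])
    also have "\<dots> = fourier (\<lambda>a. of_int (u a)) (\<lambda>a. \<chi> (a [^] p))"
      unfolding fourier_def by (intro sum.cong) (simp_all only: root)
    also have "\<dots> = fourier (\<lambda>a. of_int (u a)) \<chi>"
      by (rule fourier_comp_pow_eq[OF u p(1,2) \<chi>])
    finally show ?thesis by (simp add: fourier_def left_diff_distrib sum_subtractf)
  qed
  then have "of_int (u (?root (a [^] p))) - of_int (u (a [^] p)) = (0 :: complex)"
    using fourier_eq_0_imp_eq_0[of "\<lambda>b. of_int (u (?root b)) - of_int (u b)" "a [^] p"] a by simp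
  then show ?thesis by (simp add: root[OF a])
qed

lemma comp_pow_eq_if_prime_factors:
  assumes u: "\<And>p a. prime p \<Longrightarrow> p dvd q \<Longrightarrow> a \<in> carrier G \<Longrightarrow> u (a [^] (p::nat)) = u a"
    and "q \<noteq> 0" "b \<in> carrier G"
  shows "u (b [^] q) = u b"
  using assms
proof (induction q arbitrary: b rule: prime_divisors_induct)
  case (factor p q)
  have "u (b [^] (p * q)) = u ((b [^] p) [^] q)" using factor.prems by (simp add: nat_pow_pow)
  also have "\<dots> = u (b [^] p)" using factor.prems by (intro factor.IH) auto
  also have "\<dots> = u b" using factor.prems factor.hyps by auto
  finally show ?case .
qed auto

lemma power_invariant_if_large_primes:
  assumes u: "\<And>p a. prime p \<Longrightarrow> p > M \<Longrightarrow> a \<in> carrier G \<Longrightarrow> u (a [^] (p::nat)) = u a"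
  shows "power_invariant u"
  unfolding power_invariant_def
proof (intro allI impI ballI)
  fix k :: nat and a assume k: "coprime k (Coset.order G)" and a: "a \<in> carrier G"
  define N :: nat where "N = fact (M + 2)"
  have "N > 1" using fact_ge_self[of "M + 2"] unfolding N_def by linarith
  have "coprime k (ord a)"
    using k ord_dvd_group_order[OF a] by (meson coprime_divisors dvd_refl)
  then obtain j where j: "coprime (k + ord a * j) N"
    using exists_coprime_in_progression[of k "ord a" N] \<open>N > 1\<close> by auto
  have "u (a [^] (k + ord a * j)) = u a"
  proof (rule comp_pow_eq_if_prime_factors[OF _ _ a])
    show "k + ord a * j \<noteq> 0" using j \<open>N > 1\<close> by (intro notI) simp
    fix p b assume p: "prime p" "p dvd k + ord a * j" and b: "b \<in> carrier G"
    then have "\<not> p dvd N" using j by (meson coprime_common_divisor not_prime_unit)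
    then have "p > M" using prime_dvd_fact_iff[of p "M + 2"] p(1) by (simp only: N_def)
    then show "u (b [^] p) = u b" using p(1) b by (intro u)
  qed
  then show "u (a [^] k) = u a" by (simp add: pow_add_mult_ord[OF a])
qed

theorem integral_spectrum_iff_power_invariant:
  fixes u :: "'a \<Rightarrow> int"
  shows "integral_spectrum (\<lambda>a. of_int (u a)) \<longleftrightarrow> power_invariant u"
proof
  assume "integral_spectrum (\<lambda>a. of_int (u a))"
  then have u: "\<And>\<chi>. character \<chi> \<Longrightarrow> fourier (\<lambda>a. of_int (u a)) \<chi> \<in> \<int>"
    by (auto simp: integral_spectrum_def eigenvalue_group_matrix_iff_fourier)
  let ?M = "max (nat (2 * (\<Sum>a\<in>carrier G. \<bar>u a\<bar>))) (Coset.order G)"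
  show "power_invariant u"
  proof (rule power_invariant_if_large_primes)
    fix p a assume p: "prime p" "p > ?M" and a: "a \<in> carrier G"
    have "coprime p (Coset.order G)"
      using p order_gt_0_iff_finite by (intro prime_imp_coprime) (auto dest: dvd_imp_le)
    then show "u (a [^] p) = u a"
      using p a by (intro comp_pow_eq_large_prime u) auto
  qed
qed (auto simp: integral_spectrum_def eigenvalue_group_matrix_iff_fourier
    intro: power_invariant_imp_fourier_Ints)

end


section \<open>Cayley graphs and word length\<close>

definition has_walk :: "'v sgraph \<Rightarrow> nat \<Rightarrow> 'v \<Rightarrow> 'v \<Rightarrow> bool" where
  "has_walk \<Gamma> n u v \<longleftrightarrow> (\<exists>p. is_walk \<Gamma> u p v \<and> length p = Suc n)"

lemma graph_dist_eq_Least_has_walk: "graph_dist \<Gamma> u v = (LEAST n. has_walk \<Gamma> n u v)"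
  by (simp add: graph_dist_def has_walk_def)

lemma has_walk_0_iff: "has_walk \<Gamma> 0 u v \<longleftrightarrow> u = v \<and> u \<in> vertices \<Gamma>"
proof
  assume "u = v \<and> u \<in> vertices \<Gamma>"
  then show "has_walk \<Gamma> 0 u v"
    unfolding has_walk_def by (intro exI[of _ "[u]"]) (auto simp: is_walk_def)
qed (auto simp: has_walk_def is_walk_def length_Suc_conv)

lemma has_walk_1_iff:
  "has_walk \<Gamma> 1 u v \<longleftrightarrow> {u, v} \<in> edges \<Gamma> \<and> u \<in> vertices \<Gamma> \<and> v \<in> vertices \<Gamma>"
proof
  assume "{u, v} \<in> edges \<Gamma> \<and> u \<in> vertices \<Gamma> \<and> v \<in> vertices \<Gamma>"
  then show "has_walk \<Gamma> 1 u v"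
    unfolding has_walk_def by (intro exI[of _ "[u, v]"]) (simp add: is_walk_def)
qed (auto simp: has_walk_def is_walk_def length_Suc_conv)

lemma has_walk_sym: "has_walk \<Gamma> n u v \<longleftrightarrow> has_walk \<Gamma> n v u"
proof -
  have "is_walk \<Gamma> v (rev p) u" if "is_walk \<Gamma> u p v" for p u v
    using that by (auto simp: is_walk_def hd_rev last_rev insert_commute)
  then show ?thesis unfolding has_walk_def by (metis length_rev)
qed

lemma has_walk_trans:
  assumes "has_walk \<Gamma> m u v" "has_walk \<Gamma> n v w"
  shows "has_walk \<Gamma> (m + n) u w"
proof -
  obtain p q where p: "is_walk \<Gamma> u p v" "length p = Suc m"
    and q: "is_walk \<Gamma> v q w" "length q = Suc n"
    using assms by (auto simp: has_walk_def)
  then obtain r where "q = v # r" by (cases q) (auto simp: is_walk_def)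
  then have "is_walk \<Gamma> u (p @ r) w"
    using p q by (cases r) (auto simp: is_walk_def successively_append_iff)
  then show ?thesis
    using p(2) q(2) \<open>q = v # r\<close> unfolding has_walk_def by (intro exI[of _ "p @ r"]) simp
qed

lemma has_walk_map:
  assumes walk: "has_walk \<Gamma> n u v"
    and vertices: "\<And>a. a \<in> vertices \<Gamma> \<Longrightarrow> \<sigma> a \<in> vertices \<Gamma>"
    and edges: "\<And>a b. a \<in> vertices \<Gamma> \<Longrightarrow> b \<in> vertices \<Gamma> \<Longrightarrow> {a, b} \<in> edges \<Gamma> \<Longrightarrow>
      {\<sigma> a, \<sigma> b} \<in> edges \<Gamma>"
  shows "has_walk \<Gamma> n (\<sigma> u) (\<sigma> v)"
proof -
  obtain p where p: "is_walk \<Gamma> u p v" "length p = Suc n" using walk by (auto simp: has_walk_def)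
  then have "successively (\<lambda>a b. {\<sigma> a, \<sigma> b} \<in> edges \<Gamma>) p"
    using edges unfolding is_walk_def by (auto elim!: successively_mono)
  then have "is_walk \<Gamma> (\<sigma> u) (map \<sigma> p) (\<sigma> v)"
    using p(1) vertices by (auto simp: is_walk_def successively_map hd_map last_map)
  then show ?thesis using p(2) unfolding has_walk_def by (intro exI[of _ "map \<sigma> p"]) simp
qed

definition graph_automorphism :: "'v sgraph \<Rightarrow> ('v \<Rightarrow> 'v) \<Rightarrow> bool" where
  "graph_automorphism \<Gamma> \<sigma> \<longleftrightarrow> bij_betw \<sigma> (vertices \<Gamma>) (vertices \<Gamma>) \<and>
     (\<forall>a\<in>vertices \<Gamma>. \<forall>b\<in>vertices \<Gamma>. {\<sigma> a, \<sigma> b} \<in> edges \<Gamma> \<longleftrightarrow> {a, b} \<in> edges \<Gamma>)"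

lemma graph_dist_automorphism:
  assumes \<sigma>: "graph_automorphism \<Gamma> \<sigma>" and uv: "u \<in> vertices \<Gamma>" "v \<in> vertices \<Gamma>"
  shows "graph_dist \<Gamma> (\<sigma> u) (\<sigma> v) = graph_dist \<Gamma> u v"
proof -
  let ?\<tau> = "inv_into (vertices \<Gamma>) \<sigma>"
  have bij: "bij_betw \<sigma> (vertices \<Gamma>) (vertices \<Gamma>)"
    and edges: "\<And>a b. a \<in> vertices \<Gamma> \<Longrightarrow> b \<in> vertices \<Gamma> \<Longrightarrow>
      {\<sigma> a, \<sigma> b} \<in> edges \<Gamma> \<longleftrightarrow> {a, b} \<in> edges \<Gamma>"
    using \<sigma> by (auto simp: graph_automorphism_def)
  have \<tau>: "?\<tau> a \<in> vertices \<Gamma>" "\<sigma> (?\<tau> a) = a" if "a \<in> vertices \<Gamma>" for a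
    using bij that by (auto simp: bij_betw_def f_inv_into_f inv_into_into)
  have \<tau>_\<sigma>: "?\<tau> (\<sigma> a) = a" if "a \<in> vertices \<Gamma>" for a
    using bij that by (simp add: bij_betw_def)
  have "has_walk \<Gamma> n (\<sigma> u) (\<sigma> v) \<longleftrightarrow> has_walk \<Gamma> n u v" for n
  proof
    assume "has_walk \<Gamma> n (\<sigma> u) (\<sigma> v)"
    then have "has_walk \<Gamma> n (?\<tau> (\<sigma> u)) (?\<tau> (\<sigma> v))"
      by (rule has_walk_map) (use \<tau> edges in \<open>metis\<close>)+
    then show "has_walk \<Gamma> n u v" by (simp add: \<tau>_\<sigma> uv)
  next
    assume "has_walk \<Gamma> n u v"
    then show "has_walk \<Gamma> n (\<sigma> u) (\<sigma> v)"
      by (rule has_walk_map) (use bij edges in \<open>auto dest: bij_betwE\<close>)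
  qed
  then show ?thesis by (simp add: graph_dist_eq_Least_has_walk)
qed

lemma graph_dist_commute: "graph_dist \<Gamma> u v = graph_dist \<Gamma> v u"
  unfolding graph_dist_eq_Least_has_walk has_walk_sym[of \<Gamma> _ u v] ..

lemma graph_dist_eq_1_iff:
  assumes "has_walk \<Gamma> n u v"
  shows "graph_dist \<Gamma> u v = 1 \<longleftrightarrow> {u, v} \<in> edges \<Gamma> \<and> u \<noteq> v"
proof -
  have uv: "u \<in> vertices \<Gamma>" "v \<in> vertices \<Gamma>"
    using assms by (auto simp: has_walk_def is_walk_def)
  have attained: "has_walk \<Gamma> (graph_dist \<Gamma> u v) u v"
    unfolding graph_dist_eq_Least_has_walk using assms by (rule LeastI)
  have le: "graph_dist \<Gamma> u v \<le> m" if "has_walk \<Gamma> m u v" for m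
    unfolding graph_dist_eq_Least_has_walk using that by (rule Least_le)
  show ?thesis
  proof
    assume "graph_dist \<Gamma> u v = 1"
    then show "{u, v} \<in> edges \<Gamma> \<and> u \<noteq> v"
      using attained le[of 0] uv by (auto simp: has_walk_0_iff has_walk_1_iff[simplified])
  next
    assume "{u, v} \<in> edges \<Gamma> \<and> u \<noteq> v"
    then have "graph_dist \<Gamma> u v \<le> 1" "graph_dist \<Gamma> u v \<noteq> 0"
      using attained le[of 1] uv
      by (auto simp: has_walk_0_iff has_walk_1_iff[simplified] intro!: gr0I)
    then show "graph_dist \<Gamma> u v = 1" by linarith
  qed
qed

lemma (in group) inv_mem_iff:
  assumes B: "set_inv B = B" and g: "g \<in> carrier G"
  shows "inv g \<in> B \<longleftrightarrow> g \<in> B"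
proof -
  have "inv b \<in> B" if "b \<in> B" for b
    using B that by (auto simp: SET_INV_def)
  then show ?thesis using inv_inv[OF g] by metis
qed

locale cayley_graph = group G for G (structure) +
  fixes S :: "'a set"
  assumes S_closed: "S \<subseteq> carrier G" and S_inv: "set_inv S = S" and one_notin_S: "\<one> \<notin> S"
    and S_gen: "generate G S = carrier G"
begin

abbreviation \<Gamma> where "\<Gamma> \<equiv> Cay G S"

lemma vertices_Cay [simp]: "vertices \<Gamma> = carrier G"
  by (simp add: Cay_def)

lemma inv_mem_S_iff: "g \<in> carrier G \<Longrightarrow> inv g \<in> S \<longleftrightarrow> g \<in> S"
  by (rule inv_mem_iff[OF S_inv])

lemma edge_Cay_iff:
  assumes "g \<in> carrier G" "h \<in> carrier G"
  shows "{g, h} \<in> edges \<Gamma> \<longleftrightarrow> inv g \<otimes> h \<in> S"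
proof -
  have "inv h \<otimes> g = inv (inv g \<otimes> h)" using assms by (simp add: inv_mult_group)
  then have "inv h \<otimes> g \<in> S \<longleftrightarrow> inv g \<otimes> h \<in> S" using assms by (simp add: inv_mem_S_iff)
  then show ?thesis using assms by (auto simp: Cay_def doubleton_eq_iff)
qed

lemma graph_automorphism_translate:
  assumes g: "g \<in> carrier G"
  shows "graph_automorphism \<Gamma> (\<lambda>a. g \<otimes> a)"
proof -
  have "bij_betw (\<lambda>a. g \<otimes> a) (carrier G) (carrier G)"
    by (rule bij_betw_byWitness[where f' = "\<lambda>a. inv g \<otimes> a"])
       (use g in \<open>auto simp: m_assoc[symmetric]\<close>)
  moreover have "inv (g \<otimes> a) \<otimes> (g \<otimes> b) = inv a \<otimes> b" if "a \<in> carrier G" "b \<in> carrier G" for a b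
    using g that by (simp add: inv_mult_group m_assoc) (simp add: m_assoc[symmetric])
  ultimately show ?thesis
    using g by (simp add: graph_automorphism_def edge_Cay_iff)
qed

lemma graph_automorphism_iso:
  assumes \<phi>: "\<phi> \<in> iso G G" and S: "\<And>g. g \<in> carrier G \<Longrightarrow> \<phi> g \<in> S \<longleftrightarrow> g \<in> S"
  shows "graph_automorphism \<Gamma> \<phi>"
proof -
  interpret \<phi>: group_hom G G \<phi> using \<phi> by unfold_locales (simp add: iso_def)
  have "inv (\<phi> a) \<otimes> \<phi> b \<in> S \<longleftrightarrow> inv a \<otimes> b \<in> S" if "a \<in> carrier G" "b \<in> carrier G" for a b
    using S[of "inv a \<otimes> b"] that by simp
  then show ?thesis
    using \<phi> by (auto simp: graph_automorphism_def edge_Cay_iff iso_def)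
qed

definition word_length :: "'a \<Rightarrow> nat" where
  "word_length g = graph_dist \<Gamma> \<one> g"

lemma graph_dist_eq_word_length:
  assumes "u \<in> carrier G" "v \<in> carrier G"
  shows "graph_dist \<Gamma> u v = word_length (inv u \<otimes> v)"
  using graph_dist_automorphism[OF graph_automorphism_translate[of "inv u"], of u v] assms
  by (simp add: word_length_def)

lemma word_length_inv:
  assumes "g \<in> carrier G"
  shows "word_length (inv g) = word_length g"
  using graph_dist_eq_word_length[of g \<one>] assms graph_dist_commute[of \<Gamma> g \<one>]
  by (simp add: word_length_def)

lemma word_length_iso:
  assumes \<phi>: "\<phi> \<in> iso G G" and S: "\<And>g. g \<in> carrier G \<Longrightarrow> \<phi> g \<in> S \<longleftrightarrow> g \<in> S"
    and g: "g \<in> carrier G"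
  shows "word_length (\<phi> g) = word_length g"
proof -
  interpret \<phi>: group_hom G G \<phi> using \<phi> by unfold_locales (simp add: iso_def)
  have "graph_dist \<Gamma> (\<phi> \<one>) (\<phi> g) = graph_dist \<Gamma> \<one> g"
    using g by (intro graph_dist_automorphism graph_automorphism_iso[OF \<phi> S]) auto
  then show ?thesis by (simp add: word_length_def)
qed

lemma has_walk_from_one:
  assumes "g \<in> carrier G"
  shows "\<exists>n. has_walk \<Gamma> n \<one> g"
proof -
  have generator: "has_walk \<Gamma> 1 \<one> s" if "s \<in> S" for s
    using that S_closed by (auto simp: has_walk_1_iff[simplified] edge_Cay_iff)
  have "g \<in> generate G S" using assms S_gen by simp
  then show ?thesis
  proof induction
    case one
    show ?case by (auto simp: has_walk_0_iff intro: exI[of _ 0])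
  next
    case (incl h)
    then show ?case using generator by blast
  next
    case (inv h)
    then show ?case using generator S_closed inv_mem_S_iff by blast
  next
    case (eng h1 h2)
    then obtain m n where walks: "has_walk \<Gamma> m \<one> h1" "has_walk \<Gamma> n \<one> h2" by auto
    have h: "h1 \<in> carrier G" "h2 \<in> carrier G" using eng S_gen by auto
    have "has_walk \<Gamma> n (h1 \<otimes> \<one>) (h1 \<otimes> h2)"
      using graph_automorphism_translate[OF h(1)] h
      by (intro has_walk_map[OF walks(2)]) (auto simp: graph_automorphism_def)
    then show ?case using has_walk_trans[OF walks(1)] h by auto
  qed
qed

lemma connected_Cay: "connected_sgraph \<Gamma>"
proof -
  have "\<exists>n. has_walk \<Gamma> n u v" if "u \<in> carrier G" "v \<in> carrier G" for u v
    using has_walk_from_one that has_walk_sym has_walk_trans by metis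
  then show ?thesis unfolding connected_sgraph_def has_walk_def by auto
qed

lemma word_length_eq_1_iff:
  assumes "g \<in> carrier G"
  shows "word_length g = 1 \<longleftrightarrow> g \<in> S"
proof -
  obtain n where "has_walk \<Gamma> n \<one> g" using has_walk_from_one[OF assms] by blast
  from graph_dist_eq_1_iff[OF this] show ?thesis
    using assms one_notin_S edge_Cay_iff[of \<one> g] by (auto simp: word_length_def)
qed

lemma integral_graph_Cay_iff:
  assumes "finite (carrier G)"
  shows "integral_graph \<Gamma> \<longleftrightarrow> integral_spectrum (\<lambda>g. of_bool (g \<in> S))"
  unfolding integral_graph_def integral_spectrum_def adjacency_matrix_def group_matrix_def
    vertices_Cay eigenvalue_matrix_on[OF assms]
  by (simp add: edge_Cay_iff of_bool_def cong: if_cong)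

lemma distance_integral_graph_Cay_iff:
  assumes "finite (carrier G)"
  shows "distance_integral_graph \<Gamma> \<longleftrightarrow> integral_spectrum (\<lambda>g. of_nat (word_length g))"
  unfolding distance_integral_graph_def integral_spectrum_def distance_matrix_def group_matrix_def
    vertices_Cay eigenvalue_matrix_on[OF assms]
  by (simp add: graph_dist_eq_word_length connected_Cay)

end


section \<open>Generalized dicyclic groups\<close>

locale dicyclic = comm_group A for A (structure) +
  fixes y :: 'a
  assumes y_closed: "y \<in> carrier A" and y_square: "y \<otimes> y = \<one>"
begin

abbreviation D where "D \<equiv> Dic A y"
abbreviation emb :: "'a \<Rightarrow> 'a dic_gen gword set" where
  "emb \<equiv> dic_emb A y"

definition xemb :: "'a \<Rightarrow> 'a dic_gen gword set" where
  "xemb a = dic_x A y \<otimes>\<^bsub>D\<^esub> emb a"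

sublocale D: group D by (rule Dic_is_group)

lemma inv_y: "inv y = y"
  using y_closed y_square by (simp add: inv_equality)

lemma emb_closed [simp]: "a \<in> carrier A \<Longrightarrow> emb a \<in> carrier D"
  by (rule dic_emb_closed)

lemma xemb_closed [simp]: "a \<in> carrier A \<Longrightarrow> xemb a \<in> carrier D"
  by (simp add: xemb_def dic_x_closed)

lemma emb_emb:
  assumes "a \<in> carrier A" "b \<in> carrier A"
  shows "emb a \<otimes>\<^bsub>D\<^esub> emb b = emb (a \<otimes> b)"
  using hom_mult[OF dic_emb_hom[OF is_group] assms] by simp

lemma xemb_emb:
  assumes "a \<in> carrier A" "b \<in> carrier A"
  shows "xemb a \<otimes>\<^bsub>D\<^esub> emb b = xemb (a \<otimes> b)"
  using assms dic_x_closed[of A y] by (simp add: xemb_def D.m_assoc emb_emb)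

lemma emb_mult_x:
  assumes a: "a \<in> carrier A"
  shows "emb a \<otimes>\<^bsub>D\<^esub> dic_x A y = xemb (inv a)"
proof -
  have "xemb (inv a) \<otimes>\<^bsub>D\<^esub> inv\<^bsub>D\<^esub> dic_x A y = emb a"
    using dic_x_conj[OF is_group, of "inv a" y] a by (simp add: xemb_def)
  then show ?thesis
    using a dic_x_closed[of A y] by (metis D.inv_solve_right emb_closed inv_closed xemb_closed)
qed

lemma emb_xemb:
  assumes "a \<in> carrier A" "b \<in> carrier A"
  shows "emb a \<otimes>\<^bsub>D\<^esub> xemb b = xemb (inv a \<otimes> b)"
proof -
  have "emb a \<otimes>\<^bsub>D\<^esub> xemb b = emb a \<otimes>\<^bsub>D\<^esub> dic_x A y \<otimes>\<^bsub>D\<^esub> emb b"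
    using assms dic_x_closed[of A y] by (simp add: xemb_def D.m_assoc)
  then show ?thesis using assms by (simp add: emb_mult_x xemb_emb)
qed

lemma xemb_xemb:
  assumes "a \<in> carrier A" "b \<in> carrier A"
  shows "xemb a \<otimes>\<^bsub>D\<^esub> xemb b = emb (y \<otimes> (inv a \<otimes> b))"
proof -
  have "xemb a \<otimes>\<^bsub>D\<^esub> xemb b = dic_x A y \<otimes>\<^bsub>D\<^esub> (emb a \<otimes>\<^bsub>D\<^esub> xemb b)"
    using assms dic_x_closed[of A y] by (simp add: xemb_def[of a] D.m_assoc)
  also have "\<dots> = dic_x A y \<otimes>\<^bsub>D\<^esub> dic_x A y \<otimes>\<^bsub>D\<^esub> emb (inv a \<otimes> b)"
    using assms dic_x_closed[of A y] by (simp add: emb_xemb xemb_def[of "inv a \<otimes> b"] D.m_assoc)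
  finally show ?thesis
    using assms y_closed by (simp add: dic_x_square emb_emb)
qed

lemma inv_emb:
  assumes "a \<in> carrier A"
  shows "inv\<^bsub>D\<^esub> (emb a) = emb (inv a)"
  using assms group_hom.hom_inv[of A D emb a] dic_emb_hom[OF is_group]
  by (simp add: group_hom_def group_hom_axioms_def is_group D.is_group)

lemma inv_xemb:
  assumes "a \<in> carrier A"
  shows "inv\<^bsub>D\<^esub> (xemb a) = xemb (y \<otimes> a)"
proof (rule D.inv_equality)
  have "y \<otimes> (inv (y \<otimes> a) \<otimes> a) = \<one>"
    using assms y_closed by (simp add: inv_mult inv_y m_assoc y_square)
  moreover have "emb \<one> = \<one>\<^bsub>D\<^esub>"
    by (rule hom_one[OF dic_emb_hom[OF is_group] is_group D.is_group])
  ultimately show "xemb (y \<otimes> a) \<otimes>\<^bsub>D\<^esub> xemb a = \<one>\<^bsub>D\<^esub>"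
    using assms y_closed by (simp add: xemb_xemb)
qed (use assms y_closed in auto)

lemma inj_on_emb: "inj_on emb (carrier A)"
  by (rule dic_emb_inj[OF comm_group_axioms y_closed y_square])

lemma inj_on_xemb: "inj_on xemb (carrier A)"
  using inj_on_emb by (auto simp: inj_on_def xemb_def dic_x_closed)

lemma xemb_neq_emb:
  assumes "a \<in> carrier A" "b \<in> carrier A"
  shows "xemb a \<noteq> emb b"
proof
  assume "xemb a = emb b"
  then have "dic_x A y = emb b \<otimes>\<^bsub>D\<^esub> inv\<^bsub>D\<^esub> (emb a)"
    using assms dic_x_closed[of A y] by (simp add: xemb_def D.inv_solve_right)
  also have "\<dots> = emb (b \<otimes> inv a)" using assms by (simp add: inv_emb emb_emb)
  finally show False
    using dic_x_notin[OF comm_group_axioms y_closed y_square] assms by blast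
qed

lemma l_coset_x_emb: "dic_x A y <#\<^bsub>D\<^esub> (emb ` B) = xemb ` B"
  by (auto simp: l_coset_def xemb_def)

lemma carrier_D: "carrier D = emb ` carrier A \<union> xemb ` carrier A"
  by (simp add: Dic_carrier[OF comm_group_axioms y_closed y_square] l_coset_x_emb)

lemma carrier_D_cases:
  assumes "g \<in> carrier D"
  obtains (emb) a where "a \<in> carrier A" "g = emb a" | (xemb) a where "a \<in> carrier A" "g = xemb a"
  using assms unfolding carrier_D by blast

definition dic_case :: "('a \<Rightarrow> 'c) \<Rightarrow> ('a \<Rightarrow> 'c) \<Rightarrow> 'a dic_gen gword set \<Rightarrow> 'c" where
  "dic_case f f' g = (if g \<in> emb ` carrier A then f (inv_into (carrier A) emb g)
     else f' (inv_into (carrier A) xemb g))"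

lemma dic_case_emb [simp]: "a \<in> carrier A \<Longrightarrow> dic_case f f' (emb a) = f a"
  by (simp add: dic_case_def inj_on_emb)

lemma dic_case_xemb [simp]: "a \<in> carrier A \<Longrightarrow> dic_case f f' (xemb a) = f' a"
  using xemb_neq_emb[of a] by (auto simp: dic_case_def inj_on_xemb)

definition dic_map :: "('a \<Rightarrow> 'a) \<Rightarrow> 'a dic_gen gword set \<Rightarrow> 'a dic_gen gword set" where
  "dic_map \<psi> = dic_case (\<lambda>a. emb (\<psi> a)) (\<lambda>a. xemb (\<psi> a))"

lemma dic_map_simps [simp]:
  assumes "a \<in> carrier A"
  shows "dic_map \<psi> (emb a) = emb (\<psi> a)" "dic_map \<psi> (xemb a) = xemb (\<psi> a)"
  using assms by (simp_all add: dic_map_def)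

lemma dic_map_hom:
  assumes \<psi>: "\<psi> \<in> hom A A" and y: "\<psi> y = y"
  shows "dic_map \<psi> \<in> hom D D"
proof (rule homI)
  interpret \<psi>: group_hom A A \<psi> using \<psi> by unfold_locales
  show "dic_map \<psi> g \<in> carrier D" if "g \<in> carrier D" for g
    using that by (cases rule: carrier_D_cases) auto
  show "dic_map \<psi> (g \<otimes>\<^bsub>D\<^esub> h) = dic_map \<psi> g \<otimes>\<^bsub>D\<^esub> dic_map \<psi> h"
    if "g \<in> carrier D" "h \<in> carrier D" for g h
    using that(1)
  proof (cases rule: carrier_D_cases)
    case (emb a)
    with that(2) show ?thesis
      by (cases rule: carrier_D_cases) (auto simp: emb_emb emb_xemb)
  next
    case (xemb a)
    with that(2) show ?thesis
      by (cases rule: carrier_D_cases) (auto simp: xemb_emb xemb_xemb y y_closed)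
  qed
qed

lemma dic_map_iso:
  assumes \<psi>: "\<psi> \<in> iso A A" and y: "\<psi> y = y"
  shows "dic_map \<psi> \<in> iso D D"
proof (rule isoI)
  have hom: "\<psi> \<in> hom A A" and inj: "inj_on \<psi> (carrier A)" and surj: "\<psi> ` carrier A = carrier A"
    using \<psi> by (auto simp: iso_def bij_betw_def)
  show "dic_map \<psi> \<in> hom D D" by (rule dic_map_hom[OF hom y])
  have "bij_betw (dic_map \<psi>) (f ` carrier A) (f ` carrier A)"
    if f: "inj_on f (carrier A)" "\<And>a. a \<in> carrier A \<Longrightarrow> dic_map \<psi> (f a) = f (\<psi> a)" for f
  proof -
    have "inj_on (f \<circ> \<psi>) (carrier A)" using inj f(1) surj by (simp add: comp_inj_on)
    then have "inj_on (dic_map \<psi>) (f ` carrier A)"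
      using f(2) by (intro inj_on_imageI) (simp cong: inj_on_cong)
    moreover have "dic_map \<psi> ` f ` carrier A = f ` \<psi> ` carrier A"
      unfolding image_image by (rule image_cong) (simp_all add: f(2))
    ultimately show ?thesis by (simp add: bij_betw_def surj)
  qed
  then have "bij_betw (dic_map \<psi>) (emb ` carrier A) (emb ` carrier A)"
    "bij_betw (dic_map \<psi>) (xemb ` carrier A) (xemb ` carrier A)"
    by (simp_all add: inj_on_emb inj_on_xemb)
  moreover have "emb ` carrier A \<inter> xemb ` carrier A = {}"
    using xemb_neq_emb by fastforce
  ultimately show "bij_betw (dic_map \<psi>) (carrier D) (carrier D)"
    unfolding carrier_D by (rule bij_betw_combine)
qed

text \<open>For \<open>F = f\<^sub>1 + x f\<^sub>2\<close> this says that \<open>f\<^sub>1\<close> and \<open>f\<^sub>2\<close> are even and that \<open>f\<^sub>2\<close> is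
  invariant under translation by \<open>y\<close>.\<close>

definition dic_even :: "('a dic_gen gword set \<Rightarrow> 'c) \<Rightarrow> bool" where
  "dic_even F \<longleftrightarrow> (\<forall>g\<in>carrier D. F (inv\<^bsub>D\<^esub> g) = F g) \<and>
     (\<forall>a\<in>carrier A. F (xemb (inv a)) = F (xemb a))"

lemma dic_evenD:
  assumes "dic_even F" "a \<in> carrier A"
  shows "F (emb (inv a)) = F (emb a)" "F (xemb (inv a)) = F (xemb a)"
    "F (xemb (y \<otimes> a)) = F (xemb a)"
  using assms by (auto simp: dic_even_def simp flip: inv_emb inv_xemb)

end

locale finite_dicyclic = dicyclic A y + finite_comm_group A for A (structure) and y
begin

lemma finite_carrier_D: "finite (carrier D)"
  by (simp add: carrier_D)

lemma sum_carrier_D: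
  "(\<Sum>g\<in>carrier D. f g) = (\<Sum>a\<in>carrier A. f (emb a)) + (\<Sum>a\<in>carrier A. f (xemb a))"
proof -
  have "(\<Sum>g\<in>carrier D. f g) = (\<Sum>g\<in>emb ` carrier A. f g) + (\<Sum>g\<in>xemb ` carrier A. f g)"
    unfolding carrier_D by (rule sum.union_disjoint) (auto dest: xemb_neq_emb[symmetric])
  then show ?thesis by (simp add: sum.reindex inj_on_emb inj_on_xemb)
qed

lemma pow_y_coprime:
  assumes k: "coprime k (Coset.order A)"
  shows "y [^] (k::nat) = y"
proof -
  have square: "y [^] (2::nat) = \<one>" using y_closed y_square by (simp add: numeral_2_eq_2)
  show ?thesis
  proof (cases "even k")
    case True
    have "ord y dvd 2" using y_closed square by (simp add: pow_eq_id)
    then have "ord y dvd k" using True by (rule dvd_trans)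
    then have "ord y = 1"
      using k ord_dvd_group_order[OF y_closed] by (metis coprime_common_divisor_nat nat_dvd_1_iff_1)
    then show ?thesis using ord_eq_1 y_closed by auto
  next
    case False
    then obtain j where "k = 2 * j + 1" by (auto elim: oddE)
    moreover have "y [^] (2 * j) = \<one>"
      using nat_pow_pow[OF y_closed, of 2 j] square by simp
    ultimately show ?thesis using y_closed by simp
  qed
qed

lemma regular_rep_emb:
  assumes F: "dic_even F" and b: "b \<in> carrier A"
  shows "D.regular_rep F H (emb b) = regular_rep (\<lambda>a. F (emb a)) (\<lambda>a. H (emb a)) b
    + regular_rep (\<lambda>a. F (xemb a)) (\<lambda>a. H (xemb (inv a))) b"
proof -
  have "(\<Sum>a\<in>carrier A. F (xemb a) * H (emb b \<otimes>\<^bsub>D\<^esub> xemb a))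
      = (\<Sum>a\<in>carrier A. F (xemb (inv a)) * H (emb b \<otimes>\<^bsub>D\<^esub> xemb (inv a)))"
    by (rule sum_inv[symmetric])
  also have "\<dots> = regular_rep (\<lambda>a. F (xemb a)) (\<lambda>a. H (xemb (inv a))) b"
    using b by (simp add: regular_rep_def dic_evenD(2)[OF F] emb_xemb inv_mult cong: sum.cong)
  finally show ?thesis
    using b by (simp add: D.regular_rep_def sum_carrier_D regular_rep_def[of "\<lambda>a. F (emb a)"]
        emb_emb cong: sum.cong)
qed

lemma regular_rep_xemb:
  assumes F: "dic_even F" and b: "b \<in> carrier A"
  shows "D.regular_rep F H (xemb (inv b)) = regular_rep (\<lambda>a. F (xemb a)) (\<lambda>a. H (emb a)) b
    + regular_rep (\<lambda>a. F (emb a)) (\<lambda>a. H (xemb (inv a))) b"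
proof -
  have "(\<Sum>a\<in>carrier A. F (emb a) * H (xemb (inv b) \<otimes>\<^bsub>D\<^esub> emb a))
      = (\<Sum>a\<in>carrier A. F (emb (inv a)) * H (xemb (inv b) \<otimes>\<^bsub>D\<^esub> emb (inv a)))"
    by (rule sum_inv[symmetric])
  also have "\<dots> = regular_rep (\<lambda>a. F (emb a)) (\<lambda>a. H (xemb (inv a))) b"
    using b by (simp add: regular_rep_def dic_evenD(1)[OF F] xemb_emb inv_mult cong: sum.cong)
  finally have emb: "(\<Sum>a\<in>carrier A. F (emb a) * H (xemb (inv b) \<otimes>\<^bsub>D\<^esub> emb a))
      = regular_rep (\<lambda>a. F (emb a)) (\<lambda>a. H (xemb (inv a))) b" .
  have "(\<Sum>a\<in>carrier A. F (xemb a) * H (xemb (inv b) \<otimes>\<^bsub>D\<^esub> xemb a))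
      = (\<Sum>a\<in>carrier A. F (xemb (y \<otimes> a)) * H (emb (b \<otimes> (y \<otimes> a))))"
    using b y_closed
    by (intro sum.cong) (auto simp: dic_evenD(3)[OF F] xemb_xemb m_lcomm[of y b])
  also have "\<dots> = regular_rep (\<lambda>a. F (xemb a)) (\<lambda>a. H (emb a)) b"
    unfolding regular_rep_def by (rule sum_translate[OF y_closed])
  finally show ?thesis by (simp add: D.regular_rep_def sum_carrier_D emb)
qed

text \<open>In the coordinates \<open>h a = H (a)\<close> and \<open>k a = H (x a\<^sup>-\<^sup>1)\<close> the element \<open>f\<^sub>1 + x f\<^sub>2\<close> acts by the
  matrix with rows \<open>(f\<^sub>1, f\<^sub>2)\<close> and \<open>(f\<^sub>2, f\<^sub>1)\<close>.\<close>

lemma eigenvalue_group_matrix_D_iff: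
  assumes F: "dic_even F"
  shows "eigenvalue (D.group_matrix F) l \<longleftrightarrow>
    eigenvalue (group_matrix (\<lambda>a. F (emb a) + F (xemb a))) l \<or>
    eigenvalue (group_matrix (\<lambda>a. F (emb a) - F (xemb a))) l"
proof -
  let ?f1 = "\<lambda>a. F (emb a)" and ?f2 = "\<lambda>a. F (xemb a)"
  have ball_D: "(\<forall>g\<in>carrier D. P g) \<longleftrightarrow> (\<forall>a\<in>carrier A. P (emb a) \<and> P (xemb (inv a)))" for P
    unfolding carrier_D by auto (metis inv_closed inv_inv)
  have bex_D: "(\<exists>g\<in>carrier D. P g) \<longleftrightarrow> (\<exists>a\<in>carrier A. P (emb a) \<or> P (xemb (inv a)))" for P
    using ball_D[of "\<lambda>g. \<not> P g"] by blast
  have "eigenvalue (D.group_matrix F) l \<longleftrightarrow>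
      (\<exists>H. block_eigenvector ?f1 ?f2 l (\<lambda>a. H (emb a)) (\<lambda>a. H (xemb (inv a))))"
    unfolding D.eigenvalue_group_matrix[OF finite_carrier_D] ball_D bex_D block_eigenvector_def
    by (simp add: regular_rep_emb[OF F] regular_rep_xemb[OF F])
  also have "\<dots> \<longleftrightarrow> (\<exists>h k. block_eigenvector ?f1 ?f2 l h k)"
  proof
    assume "\<exists>h k. block_eigenvector ?f1 ?f2 l h k"
    then obtain h k where hk: "block_eigenvector ?f1 ?f2 l h k" by blast
    define H where "H = dic_case h (\<lambda>a. k (inv a))"
    have "H (emb a) = h a" "H (xemb (inv a)) = k a" if "a \<in> carrier A" for a
      using that by (simp_all add: H_def)
    then have "block_eigenvector ?f1 ?f2 l (\<lambda>a. H (emb a)) (\<lambda>a. H (xemb (inv a)))"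
      using hk unfolding block_eigenvector_def regular_rep_def by (simp cong: sum.cong)
    then show "\<exists>H. block_eigenvector ?f1 ?f2 l (\<lambda>a. H (emb a)) (\<lambda>a. H (xemb (inv a)))"
      by (intro exI[of _ H])
  qed blast
  finally show ?thesis by (simp only: ex_block_eigenvector_iff[OF finite_carrier])
qed

lemma power_invariant_add_diff_iff:
  fixes u v :: "'a \<Rightarrow> int"
  shows "power_invariant (\<lambda>a. u a + v a) \<and> power_invariant (\<lambda>a. u a - v a) \<longleftrightarrow>
    power_invariant (\<lambda>a. (u a, v a))"
proof -
  have "s + t = s' + t' \<and> s - t = s' - t' \<longleftrightarrow> s = s' \<and> t = t'" for s t s' t' :: int by auto
  then show ?thesis unfolding power_invariant_def prod.inject by blast
qed

theorem integral_spectrum_D_iff: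
  fixes F :: "'a dic_gen gword set \<Rightarrow> int"
  assumes "dic_even F"
  shows "D.integral_spectrum (\<lambda>g. of_int (F g)) \<longleftrightarrow> power_invariant (\<lambda>a. (F (emb a), F (xemb a)))"
proof -
  have "dic_even (\<lambda>g. of_int (F g) :: complex)" using assms by (simp add: dic_even_def)
  then have "D.integral_spectrum (\<lambda>g. of_int (F g)) \<longleftrightarrow>
      integral_spectrum (\<lambda>a. of_int (F (emb a) + F (xemb a))) \<and>
      integral_spectrum (\<lambda>a. of_int (F (emb a) - F (xemb a)))"
    by (auto simp: D.integral_spectrum_def integral_spectrum_def eigenvalue_group_matrix_D_iff)
  then show ?thesis
    by (simp only: integral_spectrum_iff_power_invariant power_invariant_add_diff_iff)
qed

end

locale dicyclic_cayley_graph = finite_dicyclic A y + cayley: cayley_graph "Dic A y" S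
  for A (structure) and y S +
  assumes inv_xemb_mem_S_iff: "a \<in> carrier A \<Longrightarrow> xemb (inv a) \<in> S \<longleftrightarrow> xemb a \<in> S"
begin

lemma word_length_dic_map:
  assumes \<psi>: "\<psi> \<in> iso A A" "\<psi> y = y" and g: "g \<in> carrier D"
    and S: "\<And>a. a \<in> carrier A \<Longrightarrow>
      (emb (\<psi> a) \<in> S \<longleftrightarrow> emb a \<in> S) \<and> (xemb (\<psi> a) \<in> S \<longleftrightarrow> xemb a \<in> S)"
  shows "cayley.word_length (dic_map \<psi> g) = cayley.word_length g"
proof (rule cayley.word_length_iso[OF dic_map_iso[OF \<psi>] _ g])
  show "dic_map \<psi> h \<in> S \<longleftrightarrow> h \<in> S" if "h \<in> carrier D" for h
    using that by (cases rule: carrier_D_cases) (simp_all add: S)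
qed

lemma inv_emb_mem_S_iff: "a \<in> carrier A \<Longrightarrow> emb (inv a) \<in> S \<longleftrightarrow> emb a \<in> S"
  by (simp add: cayley.inv_mem_S_iff flip: inv_emb)

lemma dic_even_mem_S: "dic_even (\<lambda>g. g \<in> S)"
  by (simp add: dic_even_def cayley.inv_mem_S_iff inv_xemb_mem_S_iff)

lemma dic_even_word_length: "dic_even cayley.word_length"
proof -
  have "cayley.word_length (xemb (inv a)) = cayley.word_length (xemb a)" if "a \<in> carrier A" for a
    using word_length_dic_map[OF inv_iso inv_y, of "xemb a"] that
    by (simp add: inv_emb_mem_S_iff inv_xemb_mem_S_iff)
  then show ?thesis by (simp add: dic_even_def cayley.word_length_inv)
qed

lemma integral_graph_iff_power_invariant:
  "integral_graph (Cay D S) \<longleftrightarrow> power_invariant (\<lambda>a. (emb a \<in> S, xemb a \<in> S))"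
proof -
  have "dic_even (\<lambda>g. of_bool (g \<in> S) :: int)" using dic_even_mem_S by (simp add: dic_even_def)
  from integral_spectrum_D_iff[OF this] show ?thesis
    by (simp add: cayley.integral_graph_Cay_iff finite_carrier_D power_invariant_def of_bool_eq_iff)
qed

lemma distance_integral_graph_iff_power_invariant:
  "distance_integral_graph (Cay D S) \<longleftrightarrow>
     power_invariant (\<lambda>a. (cayley.word_length (emb a), cayley.word_length (xemb a)))"
proof -
  have "dic_even (\<lambda>g. int (cayley.word_length g))"
    using dic_even_word_length by (simp add: dic_even_def)
  from integral_spectrum_D_iff[OF this] show ?thesis
    by (simp add: cayley.distance_integral_graph_Cay_iff finite_carrier_D power_invariant_def)
qed

lemma power_invariant_word_length_iff:
  "power_invariant (\<lambda>a. (cayley.word_length (emb a), cayley.word_length (xemb a))) \<longleftrightarrow>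
     power_invariant (\<lambda>a. (emb a \<in> S, xemb a \<in> S))"
proof
  have mem_S: "emb a \<in> S \<longleftrightarrow> cayley.word_length (emb a) = 1"
    "xemb a \<in> S \<longleftrightarrow> cayley.word_length (xemb a) = 1" if "a \<in> carrier A" for a
    using that by (simp_all add: cayley.word_length_eq_1_iff[simplified])
  assume "power_invariant (\<lambda>a. (cayley.word_length (emb a), cayley.word_length (xemb a)))"
  then show "power_invariant (\<lambda>a. (emb a \<in> S, xemb a \<in> S))"
    by (simp add: power_invariant_def mem_S)
next
  assume S: "power_invariant (\<lambda>a. (emb a \<in> S, xemb a \<in> S))"
  show "power_invariant (\<lambda>a. (cayley.word_length (emb a), cayley.word_length (xemb a)))"
    unfolding power_invariant_def
  proof (intro allI impI ballI)
    fix k :: nat and a assume k: "coprime k (Coset.order A)" and a: "a \<in> carrier A"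
    have "cayley.word_length (dic_map (\<lambda>a. a [^] k) g) = cayley.word_length g"
      if "g \<in> carrier D" for g
      using that S k
      by (intro word_length_dic_map pow_iso pow_y_coprime) (simp_all add: power_invariant_def)
    from this[of "emb a"] this[of "xemb a"] a
    show "(cayley.word_length (emb (a [^] k)), cayley.word_length (xemb (a [^] k)))
        = (cayley.word_length (emb a), cayley.word_length (xemb a))" by simp
  qed
qed

theorem distance_integral_graph_iff_integral_graph:
  "distance_integral_graph (Cay D S) \<longleftrightarrow> integral_graph (Cay D S)"
  by (simp only: distance_integral_graph_iff_power_invariant integral_graph_iff_power_invariant
      power_invariant_word_length_iff)

end

theorem theorem6p1:
  fixes A :: "('a, 'm) monoid_scheme" and y :: 'a
    and S :: "'a dic_gen gword set set" and S1 S2 :: "'a set"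
  assumes "comm_group A" and "finite (carrier A)"
    and "even (Coset.order A)" and "group_exponent A \<ge> 3"
    and "y \<in> carrier A" and "group.ord A y = 2"
    and "S \<subseteq> carrier (Dic A y)"
    and "\<one>\<^bsub>Dic A y\<^esub> \<notin> S"
    and "set_inv\<^bsub>Dic A y\<^esub> S = S"
    and "generate (Dic A y) S = carrier (Dic A y)"
    and "S1 \<subseteq> carrier A" and "S2 \<subseteq> carrier A"
    and "S = dic_emb A y ` S1 \<union> (dic_x A y <#\<^bsub>Dic A y\<^esub> (dic_emb A y ` S2))"
    and "set_inv\<^bsub>A\<^esub> S2 = S2"
  shows "distance_integral_graph (Cay (Dic A y) S) \<longleftrightarrow> integral_graph (Cay (Dic A y) S)"
proof -
  interpret A: comm_group A by fact
  have "y \<otimes>\<^bsub>A\<^esub> y = \<one>\<^bsub>A\<^esub>"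
    using A.pow_ord_eq_1[OF assms(5)] assms(5,6) by (simp add: numeral_2_eq_2)
  then interpret finite_dicyclic A y
    by unfold_locales (use assms in auto)
  interpret cayley: cayley_graph "Dic A y" S
    by unfold_locales (use assms in auto)
  have xemb_mem_S: "xemb a \<in> S \<longleftrightarrow> a \<in> S2" if "a \<in> carrier A" for a
  proof -
    have "xemb a \<notin> dic_emb A y ` S1" using xemb_neq_emb[OF that] assms(11) by blast
    then show ?thesis
      using inj_on_image_mem_iff[OF inj_on_xemb that assms(12)]
      by (simp add: assms(13) l_coset_x_emb)
  qed
  interpret dicyclic_cayley_graph A y S
    by unfold_locales (simp add: xemb_mem_S A.inv_mem_iff[OF assms(14)])
  show ?thesis by (rule distance_integral_graph_iff_integral_graph)
qed

end
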